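(* Let $p$ be a prime, let $D$ be a finite dimensional noncommutative division $\mathbb{Q}_p$-algebra whose center is $\mathbb{Q}_p$, let $\Delta$ be the ring of integers of $D$, and let $L$ be a $\mathbb{Z}_p$-Lie subalgebra of $sl_1(\Delta)$ of finite index. Then $L$ is not self-similar.
   Context: The ring of integers $\Delta$ of $D$ is the unique maximal $\mathbb{Z}_p$-order in $D$ (equivalently, the set of elements of $D$ whose reduced norm lies in $\mathbb{Z}_p$). $sl_1(\Delta)$ is the set of elements of $\Delta$ of reduced trace $0$, a $\mathbb{Z}_p$-Lie lattice under the commutator bracket of $D$. A $\mathbb{Z}_p$-Lie lattice is a finitely generated free $\mathbb{Z}_p$-module endowed with a structure of Lie algebra over $\mathbb{Z}_p$. Indices of submodules are taken with respect to the additive group structure. Let $L$ be a $\mathbb{Z}_p$-Lie lattice and $k\in\mathbb{N}=\{0,1,2,\dots\}$. A virtual endomorphism of $L$ of index $p^k$ is a Lie algebra homomorphism $\varphi:M\to L$ where $M$ is a $\mathbb{Z}_p$-subalgebra of $L$ of index $p^k$. An ideal $I$ of $L$ is $\varphi$-invariant if $I\subseteq M$ and $\varphi(I)\subseteq I$. $\varphi$ is simple if there are no nonzero $\varphi$-invariant ideals of $L$. $L$ is self-similar of index $p^k$ if there exists a simple virtual endomorphism of $L$ of index $p^k$; $L$ is self-similar if it is self-similar of index $p^k$ for some $k\in\mathbb{N}$. *)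

theory Defs
  imports
    "HOL-Algebra.Algebraic_Closure_Type"
    "HOL-Computational_Algebra.Fraction_Field"
    "Jordan_Normal_Form.Matrix"
    "Berlekamp_Zassenhaus.Finite_Field"
begin

text \<open>
  The prime \<open>p\<close> is \<open>CARD('p)\<close> for a type \<open>'p\<close> of class \<open>prime_card\<close>. The ring of
  \<open>p\<close>-adic integers is the inverse limit of the rings \<open>\<int>/p\<^sup>n\<close>, each residue class being
  represented by its least nonnegative member.
\<close>

typedef (overloaded) ('p :: prime_card) padic_int =
  "{f :: nat \<Rightarrow> int. \<forall>n. f n \<in> {0..<int CARD('p) ^ n} \<and> f (Suc n) mod int CARD('p) ^ n = f n}"
  by (rule exI[of _ "\<lambda>_. 0"]) (simp add: prime_card_int prime_gt_0_int)

setup_lifting type_definition_padic_int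

lemma card_power_pos: "0 < int CARD('p :: prime_card) ^ n"
  by (simp add: prime_card_int prime_gt_0_int)

lemma mod_Suc_power: "(a mod (q :: int) ^ Suc n) mod q ^ n = a mod q ^ n"
  by (rule mod_mod_cancel) simp

lemma padic_int_closed:
  fixes g :: "nat \<Rightarrow> int"
  assumes "\<And>n. g (Suc n) mod int CARD('p :: prime_card) ^ n = g n mod int CARD('p) ^ n"
  shows "g n mod int CARD('p) ^ n \<in> {0..<int CARD('p) ^ n} \<and>
    (g (Suc n) mod int CARD('p) ^ Suc n) mod int CARD('p) ^ n = g n mod int CARD('p) ^ n"
  using card_power_pos[of n, where 'p = 'p] assms[of n] by (simp only: mod_Suc_power) auto

instantiation padic_int :: (prime_card) comm_ring_1
begin

lift_definition zero_padic_int :: "'a padic_int" is "\<lambda>n. 0 mod int CARD('a) ^ n"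
  by (intro allI padic_int_closed) simp

lift_definition one_padic_int :: "'a padic_int" is "\<lambda>n. 1 mod int CARD('a) ^ n"
  by (intro allI padic_int_closed) simp

lift_definition plus_padic_int :: "'a padic_int \<Rightarrow> 'a padic_int \<Rightarrow> 'a padic_int"
  is "\<lambda>f g n. (f n + g n) mod int CARD('a) ^ n"
  by (intro allI padic_int_closed) (metis mod_add_eq mod_mod_trivial)

lift_definition uminus_padic_int :: "'a padic_int \<Rightarrow> 'a padic_int"
  is "\<lambda>f n. (- f n) mod int CARD('a) ^ n"
  by (intro allI padic_int_closed) (metis mod_minus_eq mod_mod_trivial)

lift_definition minus_padic_int :: "'a padic_int \<Rightarrow> 'a padic_int \<Rightarrow> 'a padic_int"
  is "\<lambda>f g n. (f n - g n) mod int CARD('a) ^ n"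
  by (intro allI padic_int_closed) (metis mod_diff_eq mod_mod_trivial)

lift_definition times_padic_int :: "'a padic_int \<Rightarrow> 'a padic_int \<Rightarrow> 'a padic_int"
  is "\<lambda>f g n. (f n * g n) mod int CARD('a) ^ n"
  by (intro allI padic_int_closed) (metis mod_mult_eq mod_mod_trivial)

instance
proof
  fix a b c :: "'a padic_int"
  show "a * b * c = a * (b * c)"
    by transfer (simp add: mod_mult_left_eq mod_mult_right_eq mult.assoc)
  show "a * b = b * a"
    by transfer (simp add: mult.commute)
  show "1 * a = a"
    by transfer (auto simp: mod_mult_left_eq)
  show "a + b + c = a + (b + c)"
    by transfer (simp add: mod_add_left_eq mod_add_right_eq add.assoc)
  show "a + b = b + a"
    by transfer (simp add: add.commute)
  show "0 + a = a"
    by transfer auto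
  show "- a + a = 0"
    by transfer (simp add: mod_add_left_eq)
  show "a - b = a + - b"
    by transfer (simp add: mod_add_right_eq)
  show "(a + b) * c = a * c + b * c"
    by transfer (simp add: mod_mult_left_eq mod_add_eq distrib_right)
  have "1 mod int CARD('a) ^ 1 = 1"
    using prime_gt_1_int[OF prime_card_int[where 'a = 'a]] by simp
  then show "(0 :: 'a padic_int) \<noteq> 1"
    by transfer (metis mod_0 zero_neq_one)
qed

end

lemma padic_int_mod:
  assumes "\<forall>n. f n \<in> {0..<int CARD('p :: prime_card) ^ n} \<and> f (Suc n) mod int CARD('p) ^ n = f n"
  shows "f (m + k) mod int CARD('p) ^ m = f m"
proof (induction k)
  case 0
  then show ?case using assms by auto
next
  case (Suc k)
  have "f (m + Suc k) mod int CARD('p) ^ m = (f (Suc (m + k)) mod int CARD('p) ^ (m + k)) mod int CARD('p) ^ m"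
    by (simp add: mod_mod_cancel le_imp_power_dvd)
  then show ?case using assms Suc by simp
qed

lemma prime_power_add_dvd_mult:
  fixes q a b :: int
  assumes "prime q" "q ^ (m + n) dvd a * b"
  shows "q ^ m dvd a \<or> q ^ n dvd b"
proof (rule ccontr)
  assume neg: "\<not> (q ^ m dvd a \<or> q ^ n dvd b)"
  then have nz: "a \<noteq> 0" "b \<noteq> 0" by auto
  have nu: "\<not> is_unit q" using assms(1) by auto
  have "multiplicity q a < m" "multiplicity q b < n"
    using neg nz nu by (auto simp: power_dvd_iff_le_multiplicity)
  moreover have "m + n \<le> multiplicity q (a * b)"
    using assms(2) nz nu by (simp add: power_dvd_iff_le_multiplicity)
  moreover have "multiplicity q (a * b) = multiplicity q a + multiplicity q b"
    using nz assms(1) by (intro prime_elem_multiplicity_mult_distrib) auto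
  ultimately show False by linarith
qed

instance padic_int :: (prime_card) idom
proof
  fix a b :: "'a padic_int"
  assume "a \<noteq> 0" "b \<noteq> 0"
  then show "a * b \<noteq> 0"
  proof transfer
    fix f g :: "nat \<Rightarrow> int"
    let ?q = "int CARD('a)"
    assume f: "\<forall>n. f n \<in> {0..<?q ^ n} \<and> f (Suc n) mod ?q ^ n = f n"
      and g: "\<forall>n. g n \<in> {0..<?q ^ n} \<and> g (Suc n) mod ?q ^ n = g n"
      and "f \<noteq> (\<lambda>n. 0 mod ?q ^ n)" "g \<noteq> (\<lambda>n. 0 mod ?q ^ n)"
    then obtain m n where "f m \<noteq> 0" "g n \<noteq> 0" by fastforce
    then have "\<not> ?q ^ m dvd f (m + n)" "\<not> ?q ^ n dvd g (m + n)"
      using padic_int_mod[OF f, of m n] padic_int_mod[OF g, of n m]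
      by (auto simp: mod_eq_0_iff_dvd[symmetric] add.commute)
    then have "(f (m + n) * g (m + n)) mod ?q ^ (m + n) \<noteq> 0"
      using prime_power_add_dvd_mult[OF prime_card_int[where 'a = 'a]]
      by (auto simp: mod_eq_0_iff_dvd)
    then show "(\<lambda>n. (f n * g n) mod ?q ^ n) \<noteq> (\<lambda>n. 0 mod ?q ^ n)"
      by (metis mod_0)
  qed
qed

type_synonym 'p padic = "'p padic_int fract"

definition zp_scale ::
  "('p :: prime_card padic \<Rightarrow> 'a \<Rightarrow> 'a) \<Rightarrow> 'p padic_int \<Rightarrow> 'a \<Rightarrow> 'a"
  where "zp_scale scale a = scale (Fract a 1)"

text \<open>
  In the presence of \<^theory>\<open>HOL-Algebra.Module\<close>, the unqualified name \<open>module\<close> denotes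
  the locale of modules over a ring record, hence the qualifications below.
\<close>

lemma zp_scale_module:
  fixes scale :: "'p :: prime_card padic \<Rightarrow> 'a :: ab_group_add \<Rightarrow> 'a"
  assumes "vector_space scale"
  shows "Modules.module (zp_scale scale)"
proof -
  interpret vector_space scale by fact
  show ?thesis
    by standard (simp_all add: zp_scale_def scale_right_distrib
      flip: scale_left_distrib One_fract_def)
qed


subsection \<open>Central algebras, orders and the reduced trace\<close>

definition finite_dim_central_algebra :: "('k :: field \<Rightarrow> 'd :: ring_1 \<Rightarrow> 'd) \<Rightarrow> bool"
  where "finite_dim_central_algebra scale \<longleftrightarrow>
    (\<exists>B. finite_dimensional_vector_space scale B) \<and>
    (\<forall>a x y. scale a x * y = scale a (x * y) \<and> x * scale a y = scale a (x * y)) \<and>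
    {z. \<forall>x. z * x = x * z} = range (\<lambda>a. scale a 1)"

definition zp_order :: "('p :: prime_card padic \<Rightarrow> 'd :: ring_1 \<Rightarrow> 'd) \<Rightarrow> 'd set \<Rightarrow> bool"
  where "zp_order scale R \<longleftrightarrow>
    1 \<in> R \<and> (\<forall>x\<in>R. \<forall>y\<in>R. x * y \<in> R) \<and>
    (\<exists>B. finite B \<and> R = Modules.module.span (zp_scale scale) B) \<and>
    Modules.module.span scale R = UNIV"

definition maximal_zp_order :: "('p :: prime_card padic \<Rightarrow> 'd :: ring_1 \<Rightarrow> 'd) \<Rightarrow> 'd set \<Rightarrow> bool"
  where "maximal_zp_order scale R \<longleftrightarrow>
    zp_order scale R \<and> (\<forall>R'. zp_order scale R' \<and> R \<subseteq> R' \<longrightarrow> R' = R)"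

text \<open>
  Homomorphisms of \<open>k\<close>-algebras \<open>\<rho> : D \<rightarrow> M\<^sub>n(K)\<close>, where \<open>K\<close> is an algebraic closure of \<open>k\<close>, are
  the same as homomorphisms of \<open>K\<close>-algebras \<open>D \<otimes>\<^sub>k K \<rightarrow> M\<^sub>n(K)\<close>. The last conjunct says that the
  latter homomorphism is bijective: a \<open>k\<close>-basis of \<open>D\<close> is mapped to a \<open>K\<close>-basis of \<open>M\<^sub>n(K)\<close>.
\<close>

definition splitting ::
  "('k :: field \<Rightarrow> 'd :: ring_1 \<Rightarrow> 'd) \<Rightarrow> nat \<Rightarrow> ('d \<Rightarrow> 'k alg_closure mat) \<Rightarrow> bool"
  where "splitting scale n \<rho> \<longleftrightarrow>
    (\<forall>x. \<rho> x \<in> carrier_mat n n) \<and>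
    \<rho> 1 = 1\<^sub>m n \<and>
    (\<forall>x y. \<rho> (x + y) = \<rho> x + \<rho> y) \<and>
    (\<forall>x y. \<rho> (x * y) = \<rho> x * \<rho> y) \<and>
    (\<forall>a x. \<rho> (scale a x) = to_ac a \<cdot>\<^sub>m \<rho> x) \<and>
    (\<exists>B. finite_dimensional_vector_space scale B \<and>
      (\<forall>A \<in> carrier_mat n n. \<exists>!c. (\<forall>b. b \<notin> B \<longrightarrow> c b = 0) \<and>
        (\<forall>i<n. \<forall>j<n. A $$ (i, j) = (\<Sum>b\<in>B. c b * \<rho> b $$ (i, j)))))"

definition has_reduced_trace ::
  "('k :: field \<Rightarrow> 'd :: ring_1 \<Rightarrow> 'd) \<Rightarrow> 'd \<Rightarrow> 'k \<Rightarrow> bool"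
  where "has_reduced_trace scale x t \<longleftrightarrow>
    (\<exists>n \<rho>. splitting scale n \<rho> \<and> (\<Sum>i<n. \<rho> x $$ (i, i)) = to_ac t)"

definition sl1 :: "('k :: field \<Rightarrow> 'd :: ring_1 \<Rightarrow> 'd) \<Rightarrow> 'd set \<Rightarrow> 'd set"
  where "sl1 scale R = {x \<in> R. has_reduced_trace scale x 0}"

definition commutator :: "'d :: ring \<Rightarrow> 'd \<Rightarrow> 'd"
  where "commutator x y = x * y - y * x"


subsection \<open>Self-similarity of Lie lattices\<close>

text \<open>
  A Lie lattice is given by its carrier \<open>L\<close> inside a type equipped with a scalar
  multiplication \<open>smul\<close> and a bracket \<open>br\<close>. That \<open>L\<close> is finitely generated and free and that
  \<open>br\<close> satisfies the Lie axioms is not part of the predicates below. It is automatic for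
  \<open>\<int>\<^sub>p\<close>-subalgebras of \<open>sl1 scale \<Delta>\<close>, with \<open>\<Delta>\<close> an order, under the commutator.
\<close>

definition lie_subalgebra ::
  "('r :: comm_ring_1 \<Rightarrow> 'a :: ab_group_add \<Rightarrow> 'a) \<Rightarrow> ('a \<Rightarrow> 'a \<Rightarrow> 'a) \<Rightarrow> 'a set \<Rightarrow> 'a set \<Rightarrow> bool"
  where "lie_subalgebra smul br L M \<longleftrightarrow>
    M \<subseteq> L \<and> Modules.module.subspace smul M \<and> (\<forall>x\<in>M. \<forall>y\<in>M. br x y \<in> M)"

definition lie_ideal ::
  "('r :: comm_ring_1 \<Rightarrow> 'a :: ab_group_add \<Rightarrow> 'a) \<Rightarrow> ('a \<Rightarrow> 'a \<Rightarrow> 'a) \<Rightarrow> 'a set \<Rightarrow> 'a set \<Rightarrow> bool"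
  where "lie_ideal smul br L I \<longleftrightarrow>
    I \<subseteq> L \<and> Modules.module.subspace smul I \<and> (\<forall>x\<in>L. \<forall>y\<in>I. br x y \<in> I)"

definition add_cosets :: "'a :: ab_group_add set \<Rightarrow> 'a set \<Rightarrow> 'a set set"
  where "add_cosets L M = (\<lambda>x. (\<lambda>y. x + y) ` M) ` L"

text \<open>
  Since \<open>p ^ k \<noteq> 0\<close>, the equation for the index entails that there are finitely many cosets.
\<close>

definition virtual_endomorphism ::
  "('p :: prime_card padic_int \<Rightarrow> 'a :: ab_group_add \<Rightarrow> 'a) \<Rightarrow> ('a \<Rightarrow> 'a \<Rightarrow> 'a) \<Rightarrow>
    'a set \<Rightarrow> nat \<Rightarrow> 'a set \<Rightarrow> ('a \<Rightarrow> 'a) \<Rightarrow> bool"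
  where "virtual_endomorphism smul br L k M \<phi> \<longleftrightarrow>
    lie_subalgebra smul br L M \<and>
    card (add_cosets L M) = CARD('p) ^ k \<and>
    \<phi> ` M \<subseteq> L \<and>
    (\<forall>x\<in>M. \<forall>y\<in>M. \<phi> (x + y) = \<phi> x + \<phi> y) \<and>
    (\<forall>a. \<forall>x\<in>M. \<phi> (smul a x) = smul a (\<phi> x)) \<and>
    (\<forall>x\<in>M. \<forall>y\<in>M. \<phi> (br x y) = br (\<phi> x) (\<phi> y))"

definition invariant_ideal ::
  "('r :: comm_ring_1 \<Rightarrow> 'a :: ab_group_add \<Rightarrow> 'a) \<Rightarrow> ('a \<Rightarrow> 'a \<Rightarrow> 'a) \<Rightarrow>
    'a set \<Rightarrow> 'a set \<Rightarrow> ('a \<Rightarrow> 'a) \<Rightarrow> 'a set \<Rightarrow> bool"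
  where "invariant_ideal smul br L M \<phi> I \<longleftrightarrow> lie_ideal smul br L I \<and> I \<subseteq> M \<and> \<phi> ` I \<subseteq> I"

definition simple_endomorphism ::
  "('r :: comm_ring_1 \<Rightarrow> 'a :: ab_group_add \<Rightarrow> 'a) \<Rightarrow> ('a \<Rightarrow> 'a \<Rightarrow> 'a) \<Rightarrow>
    'a set \<Rightarrow> 'a set \<Rightarrow> ('a \<Rightarrow> 'a) \<Rightarrow> bool"
  where "simple_endomorphism smul br L M \<phi> \<longleftrightarrow>
    \<not> (\<exists>I. I \<noteq> {0} \<and> invariant_ideal smul br L M \<phi> I)"

definition self_similar_of_index ::
  "('p :: prime_card padic_int \<Rightarrow> 'a :: ab_group_add \<Rightarrow> 'a) \<Rightarrow> ('a \<Rightarrow> 'a \<Rightarrow> 'a) \<Rightarrow>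
    'a set \<Rightarrow> nat \<Rightarrow> bool"
  where "self_similar_of_index smul br L k \<longleftrightarrow>
    (\<exists>M \<phi>. virtual_endomorphism smul br L k M \<phi> \<and> simple_endomorphism smul br L M \<phi>)"

definition self_similar ::
  "('p :: prime_card padic_int \<Rightarrow> 'a :: ab_group_add \<Rightarrow> 'a) \<Rightarrow> ('a \<Rightarrow> 'a \<Rightarrow> 'a) \<Rightarrow> 'a set \<Rightarrow> bool"
  where "self_similar smul br L \<longleftrightarrow> (\<exists>k. self_similar_of_index smul br L k)"

end

theory Submission
  imports Defs
begin

text \<open>
  A virtual endomorphism \<open>\<phi>\<close> of \<open>L\<close> extends to a Lie endomorphism \<open>\<theta>\<close> of \<open>D\<close> fixing the scalars.
  If \<open>\<theta>\<close> has a kernel, the kernel meets a deep congruence layer of \<open>L\<close> in an invariant ideal.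
  Otherwise \<open>B x y = \<theta> (\<theta>\<inverse> x \<circ> \<theta>\<inverse> y)\<close>, with \<open>\<circ>\<close> half the anticommutator, satisfies \<open>[B x x, x] = 0\<close>, which (following
  Bresar's theory of commuting traces) forces \<open>B x x\<close> to be \<open>\<alpha> x\<^sup>2\<close> up to scalars on traceless \<open>x\<close>.
  The associator identity of the traceless Jordan product then gives \<open>\<alpha> = \<plusminus>1\<close>, so that \<open>\<theta>\<close>, up to
  a sign on the traceless part, is a Jordan automorphism of \<open>D\<close> and respects powers. Hence it
  preserves the set of power-bounded elements, which is a bounded subring of \<open>D\<close> because the
  valuation of \<open>\<rat>\<^sub>p\<close> extends to \<open>D\<close>. The traceless part of a small multiple of this ring is a
  nonzero invariant ideal.
\<close>

section \<open>\<open>p\<close>-adic integers\<close>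

text \<open>Nothing makes \<open>\<theta>\<close> respect \<open>\<Delta>\<close>, so the invariant
  ideal has to come from a bounded set that the algebra alone describes. Power-boundedness is such a
  description, and it involves only powers, hence only the Jordan structure. The sign is genuine:
  for an anti-automorphism \<open>\<sigma>\<close>, the map \<open>- \<sigma>\<close> respects
  commutators too. The structural tool is \<open>sandwich_coefficient\<close>: an identity between
  sums of terms \<open>a * y * b\<close>, valid for all \<open>y\<close>, may be compared
  coefficientwise in the right factors. This turns commutator identities into linear relations in
  \<open>D\<close>. The comparison is made at \<open>t * t\<close>, for an element \<open>t\<close>
  whose square lies outside \<open>span {1, t}\<close>; if there is no such \<open>t\<close>, every
  element is quadratic and a direct argument replaces commuting traces. All traces are regular
  traces, which are defined over the base field itself; the reduced trace has the same
  kernel.\<close>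

lemma padic_int_Rep_range:
  "0 \<le> Rep_padic_int (x :: 'p :: prime_card padic_int) n"
  "Rep_padic_int x n < int CARD('p) ^ n"
  using Rep_padic_int[of x] by auto

lemma padic_int_Rep_mod:
  "Rep_padic_int (x :: 'p :: prime_card padic_int) (m + k) mod int CARD('p) ^ m = Rep_padic_int x m"
  using padic_int_mod Rep_padic_int[of x] by blast

lemma padic_int_Rep_of_nat:
  "Rep_padic_int (of_nat k :: 'p :: prime_card padic_int) n = int k mod int CARD('p) ^ n"
  by (induction k)
     (simp_all add: zero_padic_int.rep_eq plus_padic_int.rep_eq one_padic_int.rep_eq mod_simps)

lemma card_prime_card_gt_1: "1 < CARD('p :: prime_card)"
  using prime_gt_1_int[OF prime_card_int[where 'a = 'p]] by simp

instance padic_int :: (prime_card) ring_char_0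
proof
  show "inj (of_nat :: nat \<Rightarrow> 'a padic_int)"
  proof (rule injI)
    fix m k :: nat
    assume eq: "of_nat m = (of_nat k :: 'a padic_int)"
    \<comment> \<open>At precision \<open>m + k\<close> both numbers lie below the modulus, so their
      residues are the numbers themselves.\<close>
    have "m + k < CARD('a) ^ (m + k)"
      using card_prime_card_gt_1[where 'p = 'a] by (intro power_gt_expt) simp
    then have "int (m + k) < int CARD('a) ^ (m + k)"
      by (metis of_nat_less_iff of_nat_power)
    then have "int m < int CARD('a) ^ (m + k)" "int k < int CARD('a) ^ (m + k)" by linarith+
    then show "m = k"
      using arg_cong[OF eq, of "\<lambda>x. Rep_padic_int x (m + k)"] by (simp add: padic_int_Rep_of_nat)
  qed
qed

instance fract :: ("{idom,ring_char_0}") ring_char_0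
proof
  show "inj (of_nat :: nat \<Rightarrow> 'a fract)"
    by (rule injI) (simp add: Fract_of_nat_eq[symmetric] eq_fract)
qed

instance fract :: ("{idom,ring_char_0}") field_char_0 ..

lemma padic_int_dvd_iff:
  fixes x :: "'p :: prime_card padic_int"
  shows "of_nat CARD('p) ^ n dvd x \<longleftrightarrow> Rep_padic_int x n = 0"
proof
  assume "of_nat CARD('p) ^ n dvd x"
  then obtain y where x: "x = of_nat (CARD('p) ^ n) * y" by (auto simp: dvd_def)
  show "Rep_padic_int x n = 0"
    unfolding x times_padic_int.rep_eq padic_int_Rep_of_nat by simp
next
  assume 0: "Rep_padic_int x n = 0"
  let ?p = "int CARD('p)" and ?f = "Rep_padic_int x"
  have p: "?p > 0" "?p ^ i > 0" for i using card_prime_card_gt_1[where 'p = 'p] by auto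
  have dvd: "?p ^ n dvd ?f (i + n)" for i
    using padic_int_Rep_mod[of x n i] 0 by (simp add: add.commute mod_eq_0_iff_dvd)
  \<comment> \<open>Dividing by \<open>p ^ n\<close> loses \<open>n\<close> digits of precision, so
    the quotient modulo \<open>p ^ i\<close> is read off from the residue at
    \<open>i + n\<close>.\<close>
  define g where "g i = ?f (i + n) div ?p ^ n" for i
  have f: "?f (i + n) = ?p ^ n * g i" for i using dvd[of i] by (simp add: g_def)
  have g: "g i \<in> {0..<?p ^ i} \<and> g (Suc i) mod ?p ^ i = g i" for i
  proof -
    have "?p ^ n * (g (Suc i) mod ?p ^ i) = ?p ^ n * g i"
    proof -
      have "?p ^ n * (g (Suc i) mod ?p ^ i) = (?p ^ n * g (Suc i)) mod (?p ^ n * ?p ^ i)"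
        by (rule mult_mod_right)
      also have "\<dots> = ?f (Suc i + n) mod ?p ^ (i + n)"
        using f[of "Suc i"] by (simp only: power_add mult.commute)
      also have "\<dots> = ?f (i + n)"
        using padic_int_Rep_mod[of x "i + n" 1] by simp
      finally show ?thesis using f[of i] by simp
    qed
    moreover have "0 \<le> ?p ^ n * g i" "?p ^ n * g i < ?p ^ n * ?p ^ i"
      using padic_int_Rep_range[of x "i + n"] unfolding f[of i] by (simp_all only: power_add mult.commute)
    then have "0 \<le> g i" "g i < ?p ^ i"
      using p(2)[of n] by (meson zero_le_mult_iff not_less mult_less_cancel_left_pos)+
    ultimately show ?thesis using p(2)[of n] by auto
  qed
  have "x = of_nat (CARD('p) ^ n) * (Abs_padic_int g :: 'p padic_int)"
  proof (rule Rep_padic_int_inject[THEN iffD1], rule ext)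
    fix i
    have "Rep_padic_int (of_nat (CARD('p) ^ n) * (Abs_padic_int g :: 'p padic_int)) i = (?p ^ n * g i) mod ?p ^ i"
      unfolding times_padic_int.rep_eq padic_int_Rep_of_nat
      using g by (simp add: Abs_padic_int_inverse mod_simps)
    then show "Rep_padic_int x i = Rep_padic_int (of_nat (CARD('p) ^ n) * (Abs_padic_int g :: 'p padic_int)) i"
      using padic_int_Rep_mod[of x i n] f[of i] by simp
  qed
  then show "of_nat CARD('p) ^ n dvd x" by (metis dvd_triv_left of_nat_power)
qed

text \<open>\<open>x\<close> is invertible modulo every \<open>p ^ i\<close>, and the uniqueness of
  these inverses makes them compatible, so they define an element of the inverse limit.\<close>

lemma padic_int_unit:
  fixes x :: "'p :: prime_card padic_int"
  assumes "Rep_padic_int x 1 \<noteq> 0"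
  shows "x dvd 1"
proof -
  let ?p = "int CARD('p)" and ?f = "Rep_padic_int x"
  have p: "?p > 0" "?p ^ i > 0" for i using card_prime_card_gt_1[where 'p = 'p] by auto
  have cop: "coprime (?f i) (?p ^ i)" for i
  proof (cases i)
    case (Suc j)
    have "\<not> ?p dvd ?f i"
      using padic_int_Rep_mod[of x 1 j] assms Suc by (auto simp: mod_eq_0_iff_dvd)
    then show ?thesis
      using prime_imp_coprime[OF prime_card_int[where 'a = 'p]] by (simp add: coprime_commute)
  qed simp
  have ex: "\<exists>b. b \<in> {0..<?p ^ i} \<and> [?f i * b = 1] (mod ?p ^ i)" for i
  proof -
    obtain b where "[?f i * b = 1] (mod ?p ^ i)" using cong_solve_coprime_int[OF cop] by blast
    then show ?thesis
      by (intro exI[of _ "b mod ?p ^ i"]) (use p in \<open>auto simp: cong_def mod_simps\<close>)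
  qed
  then obtain g where g: "\<And>i. g i \<in> {0..<?p ^ i}" "\<And>i. [?f i * g i = 1] (mod ?p ^ i)"
    by metis
  have "g (Suc i) mod ?p ^ i = g i" for i
  proof -
    have "[?f (Suc i) * g (Suc i) = 1] (mod ?p ^ i)"
      using g(2)[of "Suc i"] by (rule cong_dvd_modulus) simp
    moreover have "[?f (Suc i) = ?f i] (mod ?p ^ i)"
      using padic_int_Rep_mod[of x i 1] padic_int_Rep_range[of x i] by (simp add: cong_def)
    ultimately have "[?f i * g (Suc i) = 1] (mod ?p ^ i)"
      by (meson cong_scalar_right cong_sym cong_trans)
    then have "[?f i * g (Suc i) = ?f i * g i] (mod ?p ^ i)"
      using g(2)[of i] by (meson cong_sym cong_trans)
    then have "[g (Suc i) = g i] (mod ?p ^ i)"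
      using cong_mult_lcancel[OF cop] by blast
    then show ?thesis using g(1)[of i] by (simp add: cong_def)
  qed
  then have "Rep_padic_int (Abs_padic_int g :: 'p padic_int) = g"
    using g(1) by (intro Abs_padic_int_inverse) auto
  then have "x * Abs_padic_int g = 1"
    using g(2) by (intro Rep_padic_int_inject[THEN iffD1] ext)
      (simp add: times_padic_int.rep_eq one_padic_int.rep_eq cong_def)
  then show ?thesis by (metis dvd_triv_left)
qed

text \<open>Up to a unit, \<open>x\<close> is a power of \<open>p\<close>. Denominators in the
  fraction field can therefore be taken to be powers of \<open>p\<close>.\<close>

lemma padic_int_dvd_power:
  fixes x :: "'p :: prime_card padic_int"
  assumes "x \<noteq> 0"
  shows "\<exists>n. x dvd of_nat CARD('p) ^ n"
proof -
  let ?p = "of_nat CARD('p) :: 'p padic_int"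
  obtain j where j: "Rep_padic_int x j \<noteq> 0"
    using assms Rep_padic_int_inject[of x 0] by (auto simp: zero_padic_int.rep_eq fun_eq_iff)
  \<comment> \<open>The residue at index 0 is always 0, so the first nonzero residue has a positive
    index; \<open>n\<close> is its predecessor.\<close>
  define n where "n = (LEAST j. Rep_padic_int x (Suc j) \<noteq> 0)"
  have "Rep_padic_int x 0 = 0" using padic_int_Rep_range[of x 0] by simp
  then obtain i where "j = Suc i" using j by (cases j) auto
  then have n: "Rep_padic_int x (Suc n) \<noteq> 0"
    unfolding n_def using j by (metis (mono_tags, lifting) LeastI)
  have "Rep_padic_int x n = 0"
  proof (cases n)
    case (Suc k)
    then show ?thesis using not_less_Least[of k "\<lambda>j. Rep_padic_int x (Suc j) \<noteq> 0"] n_def by auto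
  qed (simp add: \<open>Rep_padic_int x 0 = 0\<close>)
  then obtain y where y: "x = ?p ^ n * y" using padic_int_dvd_iff[of n x] by (auto simp: dvd_def)
  have "Rep_padic_int y 1 \<noteq> 0"
  proof
    assume "Rep_padic_int y 1 = 0"
    then have "?p ^ 1 dvd y" using padic_int_dvd_iff[of 1 y] by simp
    then have "?p ^ Suc n dvd x" unfolding y by (auto simp: dvd_def mult_ac)
    then show False using n padic_int_dvd_iff by blast
  qed
  then obtain z where "y * z = 1" using padic_int_unit by (metis dvd_def)
  then have "?p ^ n = x * z" using y by (simp add: mult.assoc)
  then have "x dvd ?p ^ n" by simp
  then show ?thesis by blast
qed

lemma padic_int_nat_approx:
  fixes x :: "'p :: prime_card padic_int"
  shows "of_nat CARD('p) ^ n dvd x - of_nat (nat (Rep_padic_int x n))"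
  using padic_int_Rep_range[of x n]
  by (simp add: padic_int_dvd_iff minus_padic_int.rep_eq padic_int_Rep_of_nat del: of_nat_nat)

text \<open>Sequential compactness of a finite power of the \<open>p\<close>-adic integers, by a
  diagonal argument: there are finitely many residue vectors modulo \<open>p ^ n\<close>, so nested
  infinite index sets \<open>N\<close> can be chosen with constant residues on
  \<open>N (Suc n)\<close>.\<close>

lemma padic_int_cluster_point:
  fixes u :: "nat \<Rightarrow> 'i \<Rightarrow> 'p :: prime_card padic_int"
  assumes "finite B"
  shows "\<exists>a. \<forall>n. \<exists>m\<ge>n. \<forall>b\<in>B. of_nat CARD('p) ^ n dvd u m b - a b"
proof -
  define r where "r n m = restrict (\<lambda>b. Rep_padic_int (u m b) n) B" for n m
  have fin: "finite (range (r n))" for n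
    by (rule finite_subset[of _ "B \<rightarrow>\<^sub>E {0..<int CARD('p) ^ n}"])
       (use assms padic_int_Rep_range in \<open>auto simp: r_def finite_PiE\<close>)
  have "\<exists>N :: nat \<Rightarrow> nat set. \<forall>n. infinite (N n) \<and> (N (Suc n) \<subseteq> N n \<and>
      (\<forall>m\<in>N (Suc n). \<forall>m'\<in>N (Suc n). r n m = r n m'))"
  proof (rule dependent_nat_choice)
    show "\<exists>x. infinite (x :: nat set)" by (rule exI[of _ UNIV]) simp
  next
    fix x n assume x: "infinite (x :: nat set)"
    obtain m0 where "m0 \<in> x" "infinite {m \<in> x. r n m = r n m0}"
      using pigeonhole_infinite[OF x, of "r n"] fin by (meson finite_subset image_mono top_greatest)
    then show "\<exists>y. infinite y \<and> y \<subseteq> x \<and> (\<forall>m\<in>y. \<forall>m'\<in>y. r n m = r n m')"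
      by (intro exI[of _ "{m \<in> x. r n m = r n m0}"]) auto
  qed
  then obtain N :: "nat \<Rightarrow> nat set" where N: "\<And>n. infinite (N n)" "\<And>n. N (Suc n) \<subseteq> N n"
    "\<And>n m m'. m \<in> N (Suc n) \<Longrightarrow> m' \<in> N (Suc n) \<Longrightarrow> r n m = r n m'"
    by metis
  define s where "s n = (SOME m. m \<in> N (Suc n))" for n
  have s: "s n \<in> N (Suc n)" for n
    unfolding s_def by (rule someI_ex) (metis N(1) ex_in_conv finite.emptyI)
  have eq: "Rep_padic_int (u m b) n = Rep_padic_int (u (s n) b) n" if "m \<in> N (Suc n)" "b \<in> B" for m n b
    using N(3)[OF that(1) s] that(2) by (metis r_def restrict_apply')
  define a where "a b = (Abs_padic_int (\<lambda>n. Rep_padic_int (u (s n) b) n) :: 'p padic_int)" for b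
  have Rep_a: "Rep_padic_int (a b) n = Rep_padic_int (u (s n) b) n" if "b \<in> B" for b n
    unfolding a_def
  proof (subst Abs_padic_int_inverse)
    have "Rep_padic_int (u (s (Suc n)) b) (Suc n) mod int CARD('p) ^ n = Rep_padic_int (u (s n) b) n" for n
      using padic_int_Rep_mod[of "u (s (Suc n)) b" n 1] eq[of "s (Suc n)" n b] s[of "Suc n"] N(2) that
      by auto
    then show "(\<lambda>n. Rep_padic_int (u (s n) b) n)
      \<in> {f. \<forall>n. f n \<in> {0..<int CARD('p) ^ n} \<and> f (Suc n) mod int CARD('p) ^ n = f n}"
      using padic_int_Rep_range by auto
  qed simp
  have "\<exists>m\<ge>n. \<forall>b\<in>B. of_nat CARD('p) ^ n dvd u m b - a b" for n
  proof -
    obtain m where m: "m \<ge> n" "m \<in> N (Suc n)"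
      using N(1)[of "Suc n"] by (metis infinite_nat_iff_unbounded_le)
    then show ?thesis
      using eq Rep_a by (auto simp: padic_int_dvd_iff minus_padic_int.rep_eq intro!: exI[of _ m])
  qed
  then show ?thesis by blast
qed

section \<open>Central division algebras\<close>

lemma commutator_simps:
  "commutator (x + y) z = commutator x z + commutator y (z :: 'd :: ring)"
  "commutator x (y + z) = commutator x y + commutator x z"
  "commutator (x - y) z = commutator x z - commutator y z"
  "commutator x (y - z) = commutator x y - commutator x z"
  "commutator (- x) y = - commutator x y"
  "commutator x (- y) = - commutator x y"
  "commutator 0 x = 0" "commutator x 0 = 0" "commutator x x = 0"
  by (simp_all add: commutator_def algebra_simps)

locale central_division_algebra = finite_dimensional_vector_space scale Basis
  for scale :: "'k :: field_char_0 \<Rightarrow> 'd :: division_ring \<Rightarrow> 'd" (infixr \<open>*s\<close> 75) and Basis +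
  assumes scale_mult_left [simp]: "(a *s x) * y = a *s (x * y)"
    and scale_mult_right [simp]: "x * (a *s y) = a *s (x * y)"
    and central_imp_scalar: "(\<And>x. z * x = x * z) \<Longrightarrow> \<exists>a. z = a *s 1"
begin

abbreviation scalars :: "'d set" where "scalars \<equiv> span {1}"

lemma scalars_iff: "x \<in> scalars \<longleftrightarrow> (\<exists>a. x = a *s 1)"
  by (auto simp: span_singleton)

lemma scalars_iff_central: "x \<in> scalars \<longleftrightarrow> (\<forall>y. commutator x y = 0)"
  using central_imp_scalar[of x] by (auto simp: scalars_iff commutator_def)

lemma span_1_iff: "x \<in> span {1, y} \<longleftrightarrow> (\<exists>a b. x = a *s y + b *s 1)"
proof -
  have "x - b *s 1 = a *s y \<longleftrightarrow> x = a *s y + b *s 1" for a b by (simp add: algebra_simps)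
  then show ?thesis by (auto simp: span_insert[of 1 "{y}"] span_singleton)
qed

lemma double_eq_0_iff: "x + x = (0 :: 'd) \<longleftrightarrow> x = 0"
proof
  assume "x + x = 0"
  then have "2 *s x = 0" by (metis one_add_one scale_left_distrib scale_one)
  then show "x = 0" by simp
qed simp

lemma double_eq_iff: "x + x = y + y \<longleftrightarrow> x = (y :: 'd)"
  using double_eq_0_iff[of "x - y"] by (auto simp: algebra_simps)

lemma commutator_scale [simp]:
  "commutator (a *s x) y = a *s commutator x y" "commutator x (a *s y) = a *s commutator x y"
  by (simp_all add: commutator_def scale_right_diff_distrib)

lemma commutator_scalar: "x \<in> scalars \<Longrightarrow> commutator x y = 0" "x \<in> scalars \<Longrightarrow> commutator y x = 0"
  by (auto simp: scalars_iff commutator_def)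

lemma commutator_scalar_1 [simp]: "commutator 1 y = 0" "commutator y 1 = (0 :: 'd)"
  by (auto simp: commutator_def)

text \<open>\<open>D \<otimes> D\<^sup>o\<^sup>p\<close> acts faithfully on \<open>D\<close>.\<close>

lemma sandwich_independent:
  assumes "independent S" "\<And>y. (\<Sum>b\<in>S. g b * y * b) = 0" "b \<in> S"
  shows "g b = 0"
proof -
  have "finite S" using assms(1) by (rule finiteI_independent)
  from this assms show ?thesis
  proof (induction S arbitrary: g b rule: finite_induct)
    case (insert e S)
    have ind: "independent S" "e \<notin> span S"
      using insert.prems(1) insert.hyps(2) by (auto simp: independent_insert)
    have "g e = 0"
    proof (rule ccontr)
      assume ge: "g e \<noteq> 0"
      define h where "h b = inverse (g e) * g b" for b
      have h: "h e = 1" using ge by (simp add: h_def)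
      have sum_h: "y * e + (\<Sum>b\<in>S. h b * y * b) = 0" for y
      proof -
        have "inverse (g e) * (\<Sum>b\<in>insert e S. g b * y * b) = 0"
          by (simp only: insert.prems(2) mult_zero_right)
        then have "(\<Sum>b\<in>insert e S. h b * y * b) = 0"
          unfolding h_def sum_distrib_left by (simp only: mult.assoc)
        then show ?thesis using insert.hyps h by simp
      qed
      \<comment> \<open>Multiplying the relation by \<open>z\<close> on the left and subtracting the
        relation at \<open>z * y\<close> cancels the term at \<open>e\<close>. The shorter relation
        then shows that each \<open>h b\<close> is central.\<close>
      have "z * h b - h b * z = 0" if "b \<in> S" for z b
      proof (rule insert.IH[OF ind(1) _ that])
        fix y
        have "(\<Sum>b\<in>S. (z * h b - h b * z) * y * b)
            = z * (y * e + (\<Sum>b\<in>S. h b * y * b)) - ((z * y) * e + (\<Sum>b\<in>S. h b * (z * y) * b))"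
          by (simp add: sum_subtractf sum_distrib_left algebra_simps)
        then show "(\<Sum>b\<in>S. (z * h b - h b * z) * y * b) = 0" by (simp only: sum_h) simp
      qed
      then have "\<exists>c. h b = c *s 1" if "b \<in> S" for b
        using that by (intro central_imp_scalar) (metis eq_iff_diff_eq_0)
      then obtain c where c: "\<And>b. b \<in> S \<Longrightarrow> h b = c b *s 1" by metis
      have "e = - (\<Sum>b\<in>S. c b *s b)"
        using sum_h[of 1] c by (simp add: eq_neg_iff_add_eq_0 cong: sum.cong)
      then have "e \<in> span S" by (simp add: span_neg span_scale span_sum span_base)
      then show False using ind by blast
    qed
    moreover have "g b = 0" if "b \<in> S" for b
      using insert.IH[OF ind(1) _ that, of g] insert.prems(2) insert.hyps \<open>g e = 0\<close> by simp
    ultimately show ?case using insert.prems(3) by auto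
  qed auto
qed

definition functional :: "('d \<Rightarrow> 'k) \<Rightarrow> bool"
  where "functional f \<longleftrightarrow> (\<forall>x y. f (x + y) = f x + f y) \<and> (\<forall>a x. f (a *s x) = a * f x)"

lemma functional_simps:
  assumes "functional f"
  shows "f (x + y) = f x + f y" "f (a *s x) = a * f x" "f 0 = 0" "f (- x) = - f x" "f (x - y) = f x - f y"
proof -
  show *: "f (x + y) = f x + f y" "f (a *s x) = a * f x" for x y a
    using assms by (auto simp: functional_def)
  show "f 0 = 0" using *(2)[of 0 0] by simp
  show "f (- x) = - f x" using *(2)[of "-1" x] by simp
  show "f (x - y) = f x - f y" using *(1)[of "x - y" y] by simp
qed

text \<open>The right factors are expanded in a basis that extends \<open>x\<close> and a basis of
  \<open>span S\<close>; by \<open>sandwich_independent\<close> the left coefficient at each basis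
  vector vanishes, and \<open>f\<close> reads the coordinate at \<open>x\<close>. In applications
  \<open>S\<close> collects the right factors whose terms are to disappear.\<close>

lemma sandwich_coefficient:
  assumes "x \<notin> span S"
  shows "\<exists>f. functional f \<and> f x = 1 \<and> (\<forall>y\<in>span S. f y = 0) \<and>
    (\<forall>ps. (\<forall>y. (\<Sum>(a, b)\<leftarrow>ps. a * y * b) = 0) \<longrightarrow> (\<Sum>(a, b)\<leftarrow>ps. f b *s a) = 0)"
proof -
  obtain T where T: "T \<subseteq> S" "independent T" "S \<subseteq> span T"
    by (rule maximal_independent_subset)
  have span: "span T = span S" using T by (metis span_eq span_superset subset_trans)
  have xT: "independent (insert x T)" "x \<notin> T"
    using independent_insertI[of x T] T(2) assms span span_base[of x T] by blast+
  define E where "E = extend_basis (insert x T)"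
  have E: "independent E" "span E = UNIV" "insert x T \<subseteq> E" "finite E"
    using independent_extend_basis[OF xT(1)] span_extend_basis[OF xT(1)] extend_basis_superset[OF xT(1)]
      finiteI_independent by (auto simp: E_def)
  define f where "f y = representation E y x" for y
  have add: "f (y + z) = f y + f z" and scale: "f (a *s y) = a * f y" for y z a
    using E by (simp_all add: f_def representation_add representation_scale)
  have "f y = 0" if "y \<in> T" for y
    using that E xT(2) by (auto simp: f_def representation_basis)
  note on_T = this
  have 0: "f y = 0" if "y \<in> span S" for y
    using that unfolding span[symmetric]
  proof (induction rule: span_induct_alt)
    case base
    then show ?case using scale[of 0 0] by simp
  qed (simp add: add scale on_T)
  have "(\<Sum>(a, b)\<leftarrow>ps. f b *s a) = 0" if "\<forall>y. (\<Sum>(a, b)\<leftarrow>ps. a * y * b) = 0" for ps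
  proof -
    have repr: "(\<Sum>e\<in>E. representation E b e *s e) = b" for b
      using E by (intro sum_representation_eq) auto
    have "(\<Sum>e\<in>E. (\<Sum>(a, b)\<leftarrow>qs. representation E b e *s a) * y * e) = (\<Sum>(a, b)\<leftarrow>qs. a * y * b)" for qs y
    proof (induction qs)
      case (Cons q qs)
      obtain a b where q: "q = (a, b)" by force
      have "a * y * b = (\<Sum>e\<in>E. (representation E b e *s a) * y * e)"
        by (subst (1) repr[of b, symmetric]) (simp add: sum_distrib_left)
      then show ?case using Cons.IH by (simp add: q distrib_right sum.distrib)
    qed simp
    then have "(\<Sum>e\<in>E. (\<Sum>(a, b)\<leftarrow>ps. representation E b e *s a) * y * e) = 0" for y
      by (simp only: that)
    then show ?thesis
      unfolding f_def by (rule sandwich_independent[OF E(1)]) (use E(3) in blast)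
  qed
  moreover have "f x = 1" using E by (simp add: f_def representation_basis)
  ultimately show ?thesis using 0 add scale by (intro exI[of _ f]) (simp add: functional_def)
qed

subsection \<open>The trace form\<close>

text \<open>The trace of left multiplication by \<open>x\<close>. It stands in for the reduced trace
  because it requires no extension of scalars; \<open>reduced_trace_eq_0_iff\<close> compares the
  kernels.\<close>

definition reg_trace :: "'d \<Rightarrow> 'k"
  where "reg_trace x = (\<Sum>b\<in>Basis. representation Basis (x * b) b)"

lemma reg_trace_add: "reg_trace (x + y) = reg_trace x + reg_trace y"
  by (simp add: reg_trace_def distrib_right representation_add independent_Basis span_Basis sum.distrib)

lemma reg_trace_scale: "reg_trace (a *s x) = a * reg_trace x"
  by (simp add: reg_trace_def representation_scale independent_Basis span_Basis sum_distrib_left)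

lemma reg_trace_diff: "reg_trace (x - y) = reg_trace x - reg_trace y"
  using reg_trace_add[of "x - y" y] by simp

lemma reg_trace_mult_commute: "reg_trace (x * y) = reg_trace (y * x)"
proof -
  let ?r = "representation Basis"
  have repr: "(\<Sum>e\<in>Basis. ?r b e *s e) = b" for b
    by (intro sum_representation_eq) (auto simp: independent_Basis span_Basis finite_Basis)
  have *: "reg_trace (x * y) = (\<Sum>b\<in>Basis. \<Sum>c\<in>Basis. ?r (y * b) c * ?r (x * c) b)" for x y
  proof -
    have "?r (x * y * b) = (\<lambda>e. \<Sum>c\<in>Basis. ?r (?r (y * b) c *s (x * c)) e)" for b
    proof -
      have "x * y * b = (\<Sum>c\<in>Basis. ?r (y * b) c *s (x * c))"
        unfolding mult.assoc by (subst repr[of "y * b", symmetric]) (simp add: sum_distrib_left)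
      then show ?thesis by (simp add: representation_sum independent_Basis span_Basis)
    qed
    then show ?thesis
      by (simp add: reg_trace_def representation_scale independent_Basis span_Basis)
  qed
  have "reg_trace (x * y) = (\<Sum>c\<in>Basis. \<Sum>b\<in>Basis. ?r (y * b) c * ?r (x * c) b)"
    unfolding * by (rule sum.swap)
  then show ?thesis by (simp add: * mult.commute)
qed

lemma reg_trace_commutator [simp]: "reg_trace (commutator x y) = 0"
  by (simp add: commutator_def reg_trace_diff reg_trace_mult_commute[of x y])

lemma reg_trace_1: "reg_trace 1 \<noteq> 0"
proof -
  have "reg_trace 1 = of_nat (card Basis)"
    by (simp add: reg_trace_def representation_basis independent_Basis)
  moreover have "Basis \<noteq> {}"
  proof
    assume "Basis = {}"
    then have "(1 :: 'd) \<in> span {}" using span_Basis by simp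
    then show False by simp
  qed
  ultimately show ?thesis by (simp add: finite_Basis)
qed

lemma reg_trace_scalar: "reg_trace (a *s 1) = 0 \<longleftrightarrow> a = 0"
  by (simp add: reg_trace_scale reg_trace_1)

text \<open>If \<open>f \<noteq> 0\<close>, then \<open>reg_trace x = f (a * x)\<close> for some \<open>a\<close>, and symmetry of both sides
  makes \<open>a\<close> central.\<close>

lemma symmetric_functional_eq_0:
  assumes "functional f" and sym: "\<And>x y. f (x * y) = f (y * x)" and f1: "f 1 = 0"
  shows "f x = 0"
proof (rule ccontr)
  assume fx: "f x \<noteq> 0"
  note add = functional_simps(1)[OF assms(1)] and scale = functional_simps(2)[OF assms(1)]
    and 0 = functional_simps(3)[OF assms(1)] and diff = functional_simps(5)[OF assms(1)]
  have nondeg: "a = 0" if "\<And>x. f (a * x) = 0" for a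
  proof (rule ccontr)
    assume "a \<noteq> 0"
    then have "f x = f (a * (inverse a * x))" by (simp flip: mult.assoc)
    then show False using that fx by simp
  qed
  have on_Basis: "g = h" if "\<And>b. b \<in> Basis \<Longrightarrow> g b = h b"
    and "\<And>x y. g (x + y) = g x + g y" "\<And>a x. g (a *s x) = a * g x"
    and "\<And>x y. h (x + y) = h x + h y" "\<And>a x. h (a *s x) = a * h x" for g h :: "'d \<Rightarrow> 'k"
  proof (rule ext)
    fix x
    have "x \<in> span Basis" by (simp add: span_Basis)
    then show "g x = h x"
    proof (induction rule: span_induct_alt)
      case base
      then show ?case using that(3)[of 0 0] that(5)[of 0 0] by simp
    qed (use that in simp)
  qed
  \<comment> \<open>The functional that maps \<open>x\<close> to \<open>f (a * x)\<close> is encoded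
    by its values on \<open>Basis\<close>, as a vector of \<open>D\<close>. Nondegeneracy makes this
    linear endomorphism injective, and a dimension count makes it surjective, so every functional
    has this form.\<close>
  define F where "F a = (\<Sum>b\<in>Basis. f (a * b) *s b)" for a
  have F: "Vector_Spaces.linear scale scale F"
    unfolding Vector_Spaces.linear_iff F_def
    by (simp add: vector_space_axioms distrib_right add scale scale_left_distrib sum.distrib scale_sum_right)
  have coord: "g b = h b" if "(\<Sum>b\<in>Basis. g b *s b) = (\<Sum>b\<in>Basis. h b *s b)" "b \<in> Basis" for g h b
  proof -
    have "(\<Sum>b\<in>Basis. (g b - h b) *s b) = 0"
      using that(1) by (simp add: scale_left_diff_distrib sum_subtractf)
    then have "g b - h b = 0"
      by (rule independentD[OF independent_Basis finite_Basis order_refl _ that(2)])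
    then show ?thesis by simp
  qed
  have "inj F"
  proof (rule injI)
    fix a a' assume "F a = F a'"
    then have "f (a * b) = f (a' * b)" if "b \<in> Basis" for b
      unfolding F_def by (rule coord) (fact that)
    then have "(\<lambda>x. f (a * x)) = (\<lambda>x. f (a' * x))"
      by (intro on_Basis) (simp_all add: distrib_left add scale)
    then have "f ((a - a') * x) = 0" for x
      by (simp add: left_diff_distrib diff fun_eq_iff)
    then show "a = a'" using nondeg by (metis eq_iff_diff_eq_0)
  qed
  then have "surj F" using F by (intro linear_inj_imp_surj)
  then obtain a where "F a = (\<Sum>b\<in>Basis. reg_trace b *s b)" by (metis surjD)
  then have "f (a * b) = reg_trace b" if "b \<in> Basis" for b
    unfolding F_def by (rule coord) (fact that)
  then have "(\<lambda>x. f (a * x)) = reg_trace"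
    by (intro on_Basis) (simp_all add: distrib_left add scale reg_trace_add reg_trace_scale)
  then have a: "f (a * x) = reg_trace x" for x by (simp add: fun_eq_iff)
  have "commutator a x = 0" for x
  proof (rule nondeg)
    fix y
    have "f (x * a * y) = f (a * (y * x))" by (metis mult.assoc sym)
    also have "\<dots> = f (a * (x * y))" unfolding a by (rule reg_trace_mult_commute)
    finally show "f (commutator a x * y) = 0"
      by (simp add: commutator_def left_diff_distrib diff mult.assoc)
  qed
  then obtain c where "a = c *s 1" using scalars_iff_central scalars_iff by blast
  then have "reg_trace 1 = 0" using a[of 1] f1 scale by simp
  then show False using reg_trace_1 by blast
qed

text \<open>A functional separating \<open>x\<close> from \<open>1\<close> and all commutators would
  be symmetric and vanish at \<open>1\<close>, hence be zero. The remaining multiple of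
  \<open>1\<close> is excluded because \<open>1\<close> has nonzero trace.\<close>

lemma reg_trace_eq_0_iff: "reg_trace x = 0 \<longleftrightarrow> x \<in> span {commutator y z | y z. True}" (is "_ \<longleftrightarrow> x \<in> span ?C")
proof
  have *: "reg_trace y = 0" if "y \<in> span ?C" for y
    using that
  proof (induction rule: span_induct_alt)
    case base
    then show ?case using reg_trace_scale[of 0 0] by simp
  next
    case (step c u v)
    from step(1) obtain y z where u: "u = commutator y z" by auto
    have "reg_trace u = 0" unfolding u by (rule reg_trace_commutator)
    then show ?case using step(2) by (simp only: reg_trace_add reg_trace_scale) simp
  qed
  then show "x \<in> span ?C \<Longrightarrow> reg_trace x = 0" .
  assume x: "reg_trace x = 0"
  have "x \<in> span (insert 1 ?C)"
  proof (rule ccontr)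
    assume "x \<notin> span (insert 1 ?C)"
    from sandwich_coefficient[OF this] obtain f where f: "functional f" "f x = 1"
      "\<And>y. y \<in> span (insert 1 ?C) \<Longrightarrow> f y = 0" by blast
    have sym: "f (y * z) = f (z * y)" for y z
    proof -
      have "f (commutator y z) = 0" by (rule f(3)) (auto intro: span_base)
      then show ?thesis by (simp add: commutator_def functional_simps[OF f(1)])
    qed
    have "f 1 = 0" by (rule f(3)) (simp add: span_base)
    with sym have "f x = 0" by (rule symmetric_functional_eq_0[OF f(1)])
    then show False using f(2) by simp
  qed
  then obtain a where a: "x - a *s 1 \<in> span ?C" unfolding span_insert by blast
  then have "reg_trace (a *s 1) = 0" using *[OF a] x by (simp add: reg_trace_diff)
  then show "x \<in> span ?C" using a by (simp add: reg_trace_scalar)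
qed

text \<open>The value 1 at \<open>1\<close> makes subtraction of \<open>ntrace x *s 1\<close> the
  projection onto the traceless elements.\<close>

definition ntrace :: "'d \<Rightarrow> 'k"
  where "ntrace x = reg_trace x / reg_trace 1"

lemma ntrace_simps [simp]:
  "ntrace (x + y) = ntrace x + ntrace y" "ntrace (x - y) = ntrace x - ntrace y"
  "ntrace (a *s x) = a * ntrace x" "ntrace 1 = 1" "ntrace 0 = 0" "ntrace (- x) = - ntrace x"
  "ntrace (commutator x y) = 0"
proof -
  have *: "ntrace 0 = 0" using reg_trace_scale[of 0 0] by (simp add: ntrace_def)
  show "ntrace (- x) = - ntrace x"
    using reg_trace_scale[of "-1" x] by (simp add: ntrace_def)
qed (use reg_trace_scale[of 0 0] in \<open>simp_all add: ntrace_def reg_trace_add reg_trace_diff reg_trace_scale reg_trace_1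
      add_divide_distrib diff_divide_distrib\<close>)

lemma ntrace_mult_commute: "ntrace (x * y) = ntrace (y * x)"
  by (simp add: ntrace_def reg_trace_mult_commute[of x y])

lemma ntrace_eq_0_iff: "ntrace x = 0 \<longleftrightarrow> x \<in> span {commutator y z | y z. True}"
  unfolding reg_trace_eq_0_iff[symmetric] ntrace_def using reg_trace_1 by simp

end

lemma commutator_antisym: "commutator y x = - commutator x (y :: 'd :: ring)"
  by (simp add: commutator_def)

lemma commutator_mult:
  "commutator (x * y) z = x * commutator y z + commutator x z * (y :: 'd :: ring)"
  "commutator z (x * y) = x * commutator z y + commutator z x * y"
  by (simp_all add: commutator_def algebra_simps)

lemma commutator_eq_0_iff: "commutator x y = 0 \<longleftrightarrow> x * y = y * (x :: 'd :: ring)"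
  by (simp add: commutator_def)

context central_division_algebra
begin

lemma span_1_square_not_in:
  assumes "t * t \<notin> span {1, t}"
  shows "t \<notin> scalars"
proof
  assume "t \<in> scalars"
  then obtain a where "t = a *s 1" by (auto simp: scalars_iff)
  then have "t * t = 0 *s t + (a * a) *s 1" by simp
  then show False using assms span_1_iff by blast
qed

text \<open>As an identity in \<open>z\<close>, the hypothesis carries \<open>t\<close> as the left
  coefficient of \<open>w\<close>. If \<open>w\<close> is outside \<open>span {1, t}\<close>,
  comparison at \<open>w\<close> makes \<open>t\<close> a scalar; otherwise \<open>w\<close> is
  essentially \<open>t\<close>, and comparison at \<open>t\<close> yields the same for
  \<open>t + t\<close>.\<close>

lemma commutator_commutator_eq_0:
  assumes "\<And>z. commutator t (commutator z w) = 0" "t \<notin> scalars"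
  shows "w \<in> scalars"
proof (rule ccontr)
  assume w: "w \<notin> scalars"
  have *: "t * y * w - t * w * y - y * w * t + w * y * t = 0" for y
    using assms(1)[of y] by (simp add: commutator_def algebra_simps)
  show False
  proof (cases "w \<in> span {1, t}")
    case True
    then obtain a b where ab: "w = a *s t + b *s 1" by (auto simp: span_1_iff)
    have "a \<noteq> 0" using w by (auto simp: scalars_iff ab)
    have "a *s (t * y * t - t * t * y - (y * t * t - t * y * t)) = 0" for y
      using *[of y] unfolding ab by (simp add: algebra_simps scale_right_diff_distrib scale_right_distrib)
    then have **: "t * y * t - t * t * y - (y * t * t - t * y * t) = 0" for y
      using \<open>a \<noteq> 0\<close> by simp
    obtain f where f: "functional f" "f t = 1" "\<And>y. y \<in> span {1} \<Longrightarrow> f y = 0"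
      "\<And>ps. (\<And>y. (\<Sum>(a, b)\<leftarrow>ps. a * y * b) = 0) \<Longrightarrow> (\<Sum>(a, b)\<leftarrow>ps. f b *s a) = 0"
      using sandwich_coefficient[OF assms(2)] by blast
    have "(\<Sum>(a, b)\<leftarrow>[(t + t, t), (- (t * t), 1), (- 1, t * t)]. f b *s a) = 0"
      by (rule f(4)) (use ** in \<open>simp add: algebra_simps\<close>)
    moreover have "f 1 = 0" by (rule f(3)) (simp add: span_base)
    ultimately have "t + t = f (t * t) *s 1" using f(2) by (simp add: algebra_simps)
    then have "2 *s t = f (t * t) *s 1" by (metis one_add_one scale_left_distrib scale_one)
    then have "t = (f (t * t) / 2) *s 1"
      by (metis scale_scale scale_one nonzero_eq_divide_eq mult.commute times_divide_eq_right zero_neq_numeral divide_self)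
    then show False using assms(2) scalars_iff by blast
  next
    case False
    obtain f where f: "functional f" "f w = 1" "\<And>y. y \<in> span {1, t} \<Longrightarrow> f y = 0"
      "\<And>ps. (\<And>y. (\<Sum>(a, b)\<leftarrow>ps. a * y * b) = 0) \<Longrightarrow> (\<Sum>(a, b)\<leftarrow>ps. f b *s a) = 0"
      using sandwich_coefficient[OF False] by blast
    have "(\<Sum>(a, b)\<leftarrow>[(t, w), (- (t * w), 1), (- 1, w * t), (w, t)]. f b *s a) = 0"
      by (rule f(4)) (use * in \<open>simp add: algebra_simps\<close>)
    moreover have "f 1 = 0" "f t = 0" by (rule f(3), simp add: span_base)+
    ultimately have "t = f (w * t) *s 1" using f(2) by (simp add: algebra_simps)
    then show False using assms(2) scalars_iff by blast
  qed
qed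

end

section \<open>Symmetric bilinear maps with commuting trace\<close>

text \<open>Equivariance under commutators is not part of the general theory of commuting traces. Here it
  shortens the elimination that determines \<open>B x x\<close>.\<close>

locale commuting_bilinear = central_division_algebra scale Basis
  for scale :: "'k :: field_char_0 \<Rightarrow> 'd :: division_ring \<Rightarrow> 'd" (infixr \<open>*s\<close> 75) and Basis +
  fixes B :: "'d \<Rightarrow> 'd \<Rightarrow> 'd"
  assumes B_add_left: "B (x + y) z = B x z + B y z"
    and B_scale_left: "B (a *s x) z = a *s B x z"
    and B_sym: "B x y = B y x"
    and B_commuting: "commutator (B x x) x = 0"
    and B_equivariant: "commutator z (B x y) = B (commutator z x) y + B x (commutator z y)"
begin

lemma B_add_right: "B x (y + z) = B x y + B x z"
  using B_add_left[of y z x] by (simp add: B_sym)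

lemma B_scale_right: "B x (a *s y) = a *s B x y"
  using B_scale_left[of a y x] by (simp add: B_sym)

lemma B_0: "B 0 x = 0" "B x 0 = 0"
  using B_scale_left[of 0 0 x] B_scale_right[of x 0 0] by auto

lemma B_diff: "B (x - y) z = B x z - B y z" "B z (x - y) = B z x - B z y"
  using B_add_left[of "x - y" y z] B_add_right[of z "x - y" y] by (simp_all add: algebra_simps)

text \<open>Adding the cubic identity \<open>B_commuting\<close> at \<open>x + y\<close> and at
  \<open>x - y\<close> leaves twice its component of degree one in \<open>x\<close>.\<close>

lemma B_polar2: "commutator (B y y) x + (commutator (B x y) y + commutator (B x y) y) = 0"
proof -
  have "commutator (B (x + y) (x + y)) (x + y) + commutator (B (x - y) (x - y)) (x - y) = 0"
    by (simp add: B_commuting)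
  then have "(commutator (B y y) x + (commutator (B x y) y + commutator (B x y) y)) +
      (commutator (B y y) x + (commutator (B x y) y + commutator (B x y) y)) = 0"
    by (simp add: B_add_left B_add_right B_diff commutator_simps B_commuting B_sym[of y x] algebra_simps)
  then show ?thesis by (simp only: double_eq_0_iff)
qed

lemma B_polar3: "commutator (B x y) z + commutator (B y z) x + commutator (B z x) y = 0"
proof -
  have "(commutator (B (y + z) (y + z)) x + (commutator (B x (y + z)) (y + z) + commutator (B x (y + z)) (y + z)))
      - (commutator (B y y) x + (commutator (B x y) y + commutator (B x y) y))
      - (commutator (B z z) x + (commutator (B x z) z + commutator (B x z) z)) = 0"
    by (simp only: B_polar2) simp
  then have "(commutator (B x y) z + commutator (B y z) x + commutator (B z x) y) +
      (commutator (B x y) z + commutator (B y z) x + commutator (B z x) y) = 0"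
    by (simp add: B_add_left B_add_right commutator_simps B_sym[of z y] B_sym[of z x] algebra_simps)
  then show ?thesis by (simp only: double_eq_0_iff)
qed

text \<open>The polarised identities for \<open>t\<close>, \<open>t * t\<close> and \<open>y\<close>
  involve the mixed values \<open>B y t\<close> and \<open>B y (t * t)\<close>. Once these are
  eliminated, only \<open>q\<close>, \<open>p\<close> and \<open>s\<close> remain, and the
  coefficient at \<open>t * t\<close> isolates \<open>q\<close>.\<close>

lemma B_square:
  assumes t: "t * t \<notin> span {1, t}"
  shows "\<exists>a b c. B t t = a *s (t * t) + b *s t + c *s 1"
proof -
  define q p s where "q = B t t" and "p = B t (t * t)" and "s = B (t * t) (t * t)"
  obtain f where f: "functional f" "f (t * t) = 1" "\<And>y. y \<in> span {1, t} \<Longrightarrow> f y = 0"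
    "\<And>ps. (\<And>y. (\<Sum>(a, b)\<leftarrow>ps. a * y * b) = 0) \<Longrightarrow> (\<Sum>(a, b)\<leftarrow>ps. f b *s a) = 0"
    using sandwich_coefficient[OF t] by blast
  have f1: "f 1 = 0" "f t = 0" by (rule f(3), simp add: span_base)+
  have id: "t * t * commutator q y + (t * commutator q y * t + t * commutator q y * t) + commutator q y * t * t
      - (t * commutator p y + t * commutator p y) - (commutator p y * t + commutator p y * t) + commutator s y = 0" for y
  proof -
    \<comment> \<open>Polarisation makes the commutators of \<open>q\<close>, \<open>p\<close> and
      \<open>s\<close> with \<open>y\<close> linear in \<open>U\<close> and \<open>V\<close>;
      \<open>id\<close> is the combination in which both cancel.\<close>
    define U V where "U = commutator (B y t) t" and "V = commutator (B y (t * t)) t"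
    have qy: "commutator q y = - (U + U)"
      unfolding eq_neg_iff_add_eq_0 q_def U_def by (rule B_polar2)
    have "commutator (B y t) (t * t) = t * U + U * t"
      by (simp add: commutator_mult U_def)
    then have py: "commutator p y = - (V + (t * U + U * t))"
      unfolding eq_neg_iff_add_eq_0 using B_polar3[of t "t * t" y]
      by (simp add: p_def V_def B_sym[of "t * t" y] add.assoc)
    have "commutator (B y (t * t)) (t * t) = t * V + V * t"
      by (simp add: commutator_mult V_def)
    then have sy: "commutator s y = - ((t * V + V * t) + (t * V + V * t))"
      unfolding eq_neg_iff_add_eq_0 s_def using B_polar2[of "t * t" y] by simp
    show ?thesis unfolding qy py sy by (simp add: algebra_simps)
  qed
  \<comment> \<open>The pairs are the terms \<open>a * y * b\<close> of \<open>id\<close>. The left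
    factor \<open>q\<close> stands with \<open>t * t\<close>, where \<open>f\<close> is 1; the other
    left factors that contain \<open>q\<close>, \<open>p\<close> or \<open>s\<close> stand with
    \<open>1\<close> or \<open>t\<close>, where \<open>f\<close> is 0.\<close>
  have "(\<Sum>(a, b)\<leftarrow>[(t * t * q, 1), (- (t * t), q), (t * q, t), (t * q, t), (- t, q * t), (- t, q * t), (q, t * t),
      (- 1, q * (t * t)), (- (t * p), 1), (- (t * p), 1), (t, p), (t, p),
      (- p, t), (- p, t), (1, p * t), (1, p * t), (s, 1), (- 1, s)].
      f b *s a) = 0"
  proof (rule f(4))
    fix y
    show "(\<Sum>(a, b)\<leftarrow>[(t * t * q, 1), (- (t * t), q), (t * q, t), (t * q, t), (- t, q * t), (- t, q * t), (q, t * t),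
      (- 1, q * (t * t)), (- (t * p), 1), (- (t * p), 1), (t, p), (t, p),
      (- p, t), (- p, t), (1, p * t), (1, p * t), (s, 1), (- 1, s)].
      a * y * b) = 0"
      using id[of y] by (simp add: commutator_def algebra_simps)
  qed
  note sum = this
  define b c where "b = f (q * t) + f (q * t) - f p - f p"
    and "c = f (q * (t * t)) - f (p * t) - f (p * t) + f s"
  have bc: "b *s t = f (q * t) *s t + f (q * t) *s t - f p *s t - f p *s t"
    "c *s 1 = f (q * (t * t)) *s 1 - f (p * t) *s 1 - f (p * t) *s 1 + f s *s 1"
    unfolding b_def c_def by (simp_all only: scale_left_distrib scale_left_diff_distrib)
  have "q = f q *s (t * t) + b *s t + c *s 1"
    unfolding bc using sum f(2) f1 by (simp add: algebra_simps)
  then show ?thesis unfolding q_def by blast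
qed

section \<open>The normalised case, in which \<open>B t t\<close> has no component along
  \<open>t * t\<close>\<close>

context
  fixes t b c0
  assumes t: "t * t \<notin> span {1, t}" and Bt: "B t t = b *s t + c0 *s 1"
begin

text \<open>The correction is chosen so that \<open>B_polar2\<close> at \<open>t\<close> becomes the
  statement that \<open>c x\<close> commutes with \<open>t\<close>.\<close>

definition "c x = B t x - (b / 2) *s x"

lemma c_add: "c (x + y) = c x + c y"
  by (simp add: c_def B_add_right scale_right_distrib)

lemma c_scale: "c (a *s x) = a *s c x"
  by (simp add: c_def B_scale_right scale_right_diff_distrib mult.commute)

lemma B_t: "B t x = c x + (b / 2) *s x"
  by (simp add: c_def)

lemma half_scale: "(b / 2) *s x + (b / 2) *s x = b *s x"
  by (simp flip: scale_left_distrib)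

lemma c_commutes: "commutator t (c x) = 0"
proof -
  have "b *s commutator t x + ((b / 2) *s commutator x t + (b / 2) *s commutator x t)
      + (commutator (c x) t + commutator (c x) t) = 0"
    using B_polar2[of t x] unfolding Bt B_sym[of x t] B_t[of x]
    by (simp add: commutator_simps algebra_simps)
  then have "commutator (c x) t + commutator (c x) t = 0"
    unfolding half_scale by (simp add: commutator_antisym[of x t])
  then show ?thesis by (simp add: double_eq_0_iff commutator_antisym[of t])
qed

lemma half_double: "(1 / 2) *s (x + x) = x"
  by (simp add: scale_right_distrib flip: scale_left_distrib)

text \<open>Equivariance under \<open>t\<close> itself: the term \<open>B (commutator t t) y\<close>
  vanishes, and \<open>c y\<close> commutes with \<open>t\<close>. In other words, \<open>c\<close>
  vanishes on commutators with \<open>t\<close>.\<close>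

lemma B_t_commutator: "B t (commutator t y) = (b / 2) *s commutator t y"
  using B_equivariant[of t t y] c_commutes[of y] by (simp add: B_t commutator_simps B_0)

text \<open>The commutator of \<open>t * t\<close> with \<open>B x (commutator t y)\<close> is
  computed in two ways. In the resulting identity \<open>id\<close> the variable \<open>y\<close> no
  longer occurs inside \<open>B\<close>, so coefficients can be compared; the one at
  \<open>t * t\<close> expresses \<open>c x\<close> through \<open>t * t\<close>, \<open>t\<close>,
  \<open>x\<close> and \<open>1\<close>.\<close>

lemma c_eq_span:
  assumes x: "commutator t x \<noteq> 0"
  shows "c x \<in> span {1, t}"
proof -
  define e p where "e = B (t * t) x" and "p = c (t * t)"
  have cx: "c x * t = t * c x" "c x * (t * z) = t * (c x * z)" for z
    using c_commutes[of x] by (simp_all add: commutator_def flip: mult.assoc)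
  have B_tt: "commutator t (B (t * t) y) = commutator p y" for y
  proof -
    have "commutator t (B (t * t) y) + commutator (t * t) (B t y) = commutator (B t (t * t)) y"
      using B_polar3[of t "t * t" y]
      by (simp add: commutator_antisym[of _ t] commutator_antisym[of _ "t * t"] B_sym[of y t] algebra_simps)
    moreover have "commutator (t * t) (c y) = 0"
      using c_commutes[of y] by (simp add: commutator_mult)
    ultimately show ?thesis
      by (simp add: B_t p_def commutator_simps)
  qed
  have id: "t * commutator (c x) (commutator t y) + commutator (c x) (commutator t y) * t
      = commutator e (commutator t y) + commutator (commutator p y) x" for y
  proof -
    let ?y = "commutator t y"
    have "commutator t (B x ?y) = commutator (c x) ?y"
      using B_polar3[of t x ?y]
      by (simp add: B_sym[of ?y t] B_t_commutator B_t[of x] commutator_simps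
          commutator_antisym[of _ t] commutator_antisym[of ?y x])
    moreover have "B (t * t) ?y = commutator p y"
      using B_equivariant[of t "t * t" y] B_tt[of y] by (simp add: commutator_mult commutator_simps B_0)
    then have "commutator (t * t) (B x ?y) = commutator e ?y + commutator (commutator p y) x"
      using B_polar3[of "t * t" x ?y]
      by (simp add: e_def B_sym[of ?y "t * t"] commutator_antisym[of _ "t * t"] algebra_simps)
    ultimately show ?thesis by (simp add: commutator_mult)
  qed
  have "t * t \<notin> span {x, 1, t}"
  proof
    assume "t * t \<in> span {x, 1, t}"
    then obtain k where k: "t * t - k *s x \<in> span {1, t}" by (auto simp: span_insert[of x])
    then obtain a d where "t * t - k *s x = a *s t + d *s 1" by (auto simp: span_1_iff)
    then have "commutator t (t * t - k *s x) = 0" by (simp add: commutator_simps)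
    then have "k = 0" using x by (simp add: commutator_simps commutator_mult)
    then show False using k t by simp
  qed
  from sandwich_coefficient[OF this] obtain f where f: "functional f" "f (t * t) = 1"
    "\<And>y. y \<in> span {x, 1, t} \<Longrightarrow> f y = 0"
    "\<And>ps. (\<And>y. (\<Sum>(a, b)\<leftarrow>ps. a * y * b) = 0) \<Longrightarrow> (\<Sum>(a, b)\<leftarrow>ps. f b *s a) = 0" by blast
  have f1: "f 1 = 0" "f t = 0" "f x = 0" by (rule f(3), simp add: span_base)+
  have "(\<Sum>(a, b)\<leftarrow>[(t * (t * c x), 1), (- c x, t * t), (- (t * t), c x), (1, t * (t * c x)), (- (e * t), 1), (e, t),
      (t, e), (- 1, t * e), (x * p, 1), (- x, p), (- p, x), (1, p * x)]. f b *s a) = 0"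
  proof (rule f(4))
    fix y
    show "(\<Sum>(a, b)\<leftarrow>[(t * (t * c x), 1), (- c x, t * t), (- (t * t), c x), (1, t * (t * c x)), (- (e * t), 1), (e, t),
      (t, e), (- 1, t * e), (x * p, 1), (- x, p), (- p, x), (1, p * x)]. a * y * b) = 0"
      using id[of y] by (simp add: commutator_def algebra_simps cx)
  qed
  then have cx': "c x = f e *s t - f (c x) *s (t * t) - f p *s x + (f (t * (t * c x)) - f (t * e) + f (p * x)) *s 1"
    using f(2) f1 by (simp add: algebra_simps scale_left_distrib scale_left_diff_distrib)
  \<comment> \<open>Commuting with \<open>t\<close> removes the coefficient of \<open>x\<close>,
    since \<open>x\<close> does not commute with \<open>t\<close>. Applying \<open>f\<close>
    afterwards shows that the coefficient of \<open>t * t\<close> equals its own negative.\<close>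
  then have "commutator t (c x) = commutator t (f e *s t - f (c x) *s (t * t) - f p *s x
      + (f (t * (t * c x)) - f (t * e) + f (p * x)) *s 1)" by (rule arg_cong)
  also have "\<dots> = - (f p *s commutator t x)"
    by (simp add: commutator_simps commutator_mult)
  finally have "commutator t (c x) = - (f p *s commutator t x)" .
  then have fp: "f p = 0" using c_commutes x by simp
  have "f (c x) = f (f e *s t - f (c x) *s (t * t) - f p *s x
      + (f (t * (t * c x)) - f (t * e) + f (p * x)) *s 1)" using cx' by (rule arg_cong)
  also have "\<dots> = - f (c x)"
    by (simp add: functional_simps[OF f(1)] f1 f(2) fp)
  finally have "f (c x) = - f (c x)" .
  then have "f (c x) + f (c x) = 0" unfolding eq_neg_iff_add_eq_0 .
  then have "f (c x) = 0" by (simp flip: mult_2)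
  then have "c x = f e *s t + (f (t * (t * c x)) - f (t * e) + f (p * x)) *s 1"
    using cx' fp by simp
  then show ?thesis unfolding span_1_iff by blast
qed

lemma c_in_span: "c x \<in> span {1, t}"
proof (cases "commutator t x = 0")
  case True
  obtain x0 where x0: "commutator t x0 \<noteq> 0"
    using span_1_square_not_in[OF t] scalars_iff_central by blast
  \<comment> \<open>On the centraliser of \<open>t\<close>, \<open>c_eq_span\<close> says nothing;
    adding \<open>x0\<close> leaves the centraliser.\<close>
  then have "c (x + x0) \<in> span {1, t}"
    using True by (intro c_eq_span) (simp add: commutator_simps)
  then have "c (x + x0) - c x0 \<in> span {1, t}" using c_eq_span[OF x0] by (rule span_diff)
  then show ?thesis by (simp add: c_add)
qed (rule c_eq_span)

text \<open>Modulo scalars \<open>c x\<close> is \<open>\<kappa> x *s t\<close>, and polarisation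
  then suggests that \<open>B y y\<close> is twice \<open>\<kappa> y *s y\<close>. The difference
  \<open>w y\<close> commutes with \<open>t\<close>, and equivariance forces it to be a
  scalar.\<close>

lemma B_square_normalized:
  "\<exists>\<kappa>. functional \<kappa> \<and> (\<forall>x y. \<kappa> (commutator x y) = 0) \<and> (\<forall>y. B y y - \<kappa> y *s y \<in> scalars)"
proof -
  have tns: "t \<notin> scalars" using t by (rule span_1_square_not_in)
  obtain f where f: "functional f" "f t = 1" "\<And>y. y \<in> scalars \<Longrightarrow> f y = 0"
    using sandwich_coefficient[OF tns] by blast
  define \<kappa> where "\<kappa> x = f (c x)" for x
  have \<kappa>: "functional \<kappa>"
    by (simp add: functional_def \<kappa>_def c_add c_scale functional_simps[OF f(1)])
  have "c x - \<kappa> x *s t \<in> scalars" for x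
  proof -
    obtain a d where ad: "c x = a *s t + d *s 1" using c_in_span[of x] span_1_iff by blast
    have "f (d *s 1) = 0" using f(3) scalars_iff by blast
    then have "\<kappa> x = a" unfolding \<kappa>_def ad by (simp add: functional_simps[OF f(1)] f(2))
    then show ?thesis using ad scalars_iff by simp
  qed
  then have c: "commutator (c x) y = \<kappa> x *s commutator t y" for x y
    using commutator_scalar(1)[of "c x - \<kappa> x *s t" y] by (simp add: commutator_simps)
  define w where "w y = B y y - (\<kappa> y *s y + \<kappa> y *s y)" for y
  define B' where "B' x y = B x y - \<kappa> x *s y - \<kappa> y *s x" for x y
  have w_t: "commutator t (w y) = 0" for y
  proof -
    have "commutator (B y y) t + (\<kappa> y *s commutator t y + \<kappa> y *s commutator t y) = 0"
      using B_polar2[of y t] by (simp add: B_t c commutator_simps)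
    then show ?thesis
      by (simp add: w_def commutator_simps scale_left_distrib commutator_antisym[of _ t]
          eq_neg_iff_add_eq_0 algebra_simps)
  qed
  have w_y: "commutator y (w y) = 0" for y
    using B_commuting[of y] by (simp add: w_def commutator_simps commutator_antisym[of y])
  have w_add: "w (x + y) = w x + w y + (B' x y + B' x y)" for x y
    by (simp add: w_def B'_def B_add_left B_add_right B_sym[of y x] functional_simps[OF \<kappa>]
        scale_left_distrib scale_right_distrib algebra_simps)
  have B'_t: "commutator t (B' x y) = 0" for x y
  proof -
    have "commutator t (w (x + y)) = commutator t (w x + w y + (B' x y + B' x y))"
      by (simp only: w_add)
    then have "commutator t (B' x y) + commutator t (B' x y) = 0"
      by (simp add: w_t commutator_simps)
    then show ?thesis by (simp only: double_eq_0_iff)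
  qed
  have zw: "commutator z (w y) = (B' (commutator z y) y + B' (commutator z y) y)
      + (\<kappa> (commutator z y) *s y + \<kappa> (commutator z y) *s y)" for z y
    by (simp add: w_def B'_def commutator_simps B_equivariant[of z y y] B_sym[of y "commutator z y"]
        scale_left_distrib algebra_simps)
  have tzw: "commutator t (commutator z (w y)) = (\<kappa> (commutator z y) + \<kappa> (commutator z y)) *s commutator t y" for z y
    unfolding zw by (simp only: commutator_simps commutator_scale B'_t scale_left_distrib add_0)
  have w: "w y \<in> scalars" for y
  proof (rule ccontr)
    assume ns: "w y \<notin> scalars"
    have "commutator t (commutator z (w y)) = 0" for z
    proof (rule ccontr)
      assume nz: "commutator t (commutator z (w y)) \<noteq> 0"
      define h u where "h = \<kappa> (commutator z y) + \<kappa> (commutator z y)" and "u = commutator t y"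
      have hu: "h \<noteq> 0" "u \<noteq> 0" using nz tzw by (auto simp: h_def u_def)
      \<comment> \<open>Replacing \<open>z\<close> by \<open>z * w y\<close> multiplies the double
        commutator by \<open>w y\<close>, because \<open>w y\<close> commutes with \<open>t\<close>
        and with itself. Both double commutators are multiples of \<open>u\<close>, so
        \<open>w y\<close> is a scalar.\<close>
      define h' where "h' = \<kappa> (commutator (z * w y) y) + \<kappa> (commutator (z * w y) y)"
      have "h' *s u = commutator t (commutator (z * w y) (w y))"
        by (simp only: tzw h'_def u_def)
      also have "\<dots> = commutator t (commutator z (w y)) * w y"
        by (simp add: commutator_mult w_t commutator_simps)
      also have "\<dots> = h *s (u * w y)" by (simp only: tzw h_def u_def scale_mult_left)
      finally have "u * (h' *s 1) = u * (h *s w y)" by simp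
      then have "h' *s 1 = h *s w y" using hu by (metis mult_left_cancel)
      then have "w y = inverse h *s (h' *s 1)" using hu by simp
      then show False using ns scalars_iff by (metis scale_scale)
    qed
    then show False using commutator_commutator_eq_0[OF _ tns] ns by blast
  qed
  have B': "B' x y \<in> scalars" for x y
  proof -
    have "w (x + y) - w x - w y \<in> scalars" using w by (intro span_diff)
    then have "(1 / 2) *s (B' x y + B' x y) \<in> scalars" by (simp add: w_add span_scale)
    then show ?thesis by (simp only: half_double)
  qed
  have "\<kappa> (commutator z y) = 0" for z y
  proof (rule ccontr)
    assume k: "\<kappa> (commutator z y) \<noteq> 0"
    define h where "h = \<kappa> (commutator z y) + \<kappa> (commutator z y)"
    have h: "h \<noteq> 0" using k by (simp add: h_def flip: mult_2)
    have "(B' (commutator z y) y + B' (commutator z y) y) + h *s y = 0"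
      using zw[of z y] commutator_scalar(2)[OF w] by (simp only: h_def scale_left_distrib)
    then have "h *s y = - (B' (commutator z y) y + B' (commutator z y) y)"
      by (simp only: add_eq_0_iff)
    also have "\<dots> \<in> scalars" using B' by (intro span_neg span_add)
    finally have "inverse h *s (h *s y) \<in> scalars" by (rule span_scale)
    then have "y \<in> scalars" using h by simp
    then have "commutator z y = 0" by (rule commutator_scalar)
    then show False using k functional_simps(3)[OF \<kappa>] by simp
  qed
  moreover have "B y y - (\<kappa> y + \<kappa> y) *s y \<in> scalars" for y
    using w[of y] unfolding w_def by (simp only: scale_left_distrib)
  moreover have "functional (\<lambda>y. \<kappa> y + \<kappa> y)"
    by (simp add: functional_def functional_simps[OF \<kappa>] algebra_simps)
  ultimately show ?thesis by (intro exI[of _ "\<lambda>y. \<kappa> y + \<kappa> y"]) simp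
qed

end

text \<open>Subtracting \<open>a\<close> times half the anticommutator keeps the assumptions on
  \<open>B\<close> and removes \<open>t * t\<close> from \<open>B t t\<close>, which is the
  normalised case.\<close>

theorem B_square_form:
  assumes t: "t * t \<notin> span {1, t}"
  shows "\<exists>\<alpha> \<kappa>. functional \<kappa> \<and> (\<forall>x y. \<kappa> (commutator x y) = 0) \<and>
    (\<forall>y. B y y - \<alpha> *s (y * y) - \<kappa> y *s y \<in> scalars)"
proof -
  obtain a b c0 where B_tt: "B t t = a *s (t * t) + b *s t + c0 *s 1" using B_square[OF t] by blast
  define B' where "B' x y = B x y - (a / 2) *s (x * y + y * x)" for x y
  have sq: "B' y y = B y y - a *s (y * y)" for y
    by (simp add: B'_def scale_right_distrib flip: scale_left_distrib)
  interpret B': commuting_bilinear scale Basis B'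
  proof
    fix x y z c
    show "B' (x + y) z = B' x z + B' y z"
      by (simp add: B'_def B_add_left scale_right_distrib algebra_simps)
    show "B' (c *s x) z = c *s B' x z"
      by (simp add: B'_def B_scale_left scale_right_distrib scale_right_diff_distrib mult.commute)
    show "B' x y = B' y x"
      by (simp add: B'_def B_sym[of x y] add.commute)
    show "commutator (B' x x) x = 0"
      unfolding sq by (simp add: commutator_simps B_commuting commutator_mult)
    show "commutator z (B' x y) = B' (commutator z x) y + B' x (commutator z y)"
      by (simp add: B'_def commutator_simps commutator_mult B_equivariant scale_right_distrib algebra_simps)
  qed
  have "B' t t = b *s t + c0 *s 1" by (simp add: sq B_tt)
  from B'.B_square_normalized[OF t this] show ?thesis unfolding sq by blast
qed

end

section \<open>Lie automorphisms\<close>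

context central_division_algebra
begin

text \<open>Traceless elements are combinations of commutators. This removes \<open>\<kappa>\<close>
  on traceless elements and shows that Lie automorphisms fixing \<open>1\<close> preserve
  \<open>ntrace\<close>.\<close>

lemma ntrace_unique:
  assumes f: "functional f" and "\<And>x y. f (commutator x y) = 0"
  shows "f x = ntrace x * f 1"
proof -
  have "f y = 0" if "y \<in> span {commutator y z | y z. True}" for y
    using that
  proof (induction rule: span_induct_alt)
    case base
    then show ?case by (rule functional_simps(3)[OF f])
  next
    case (step c u v)
    from step(1) obtain y z where "u = commutator y z" by auto
    then show ?case using step(2) assms(2) by (simp add: functional_simps[OF f])
  qed
  moreover have "x - ntrace x *s 1 \<in> span {commutator y z | y z. True}"
    unfolding ntrace_eq_0_iff[symmetric] by simp
  ultimately have "f (x - ntrace x *s 1) = 0" by blast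
  then show ?thesis by (simp add: functional_simps[OF f])
qed

lemma traceless_scalar: "x \<in> scalars \<Longrightarrow> ntrace x = 0 \<Longrightarrow> x = 0"
  by (auto simp: scalars_iff)

lemma commutator_diff_scalar [simp]:
  "commutator (x - a *s 1) y = commutator x y" "commutator y (x - a *s 1) = commutator y x"
  by (simp_all add: commutator_simps)

text \<open>Completing the square gives \<open>u\<close> with scalar square. Then \<open>u\<close>
  anticommutes with a nonzero commutator \<open>commutator u y\<close>, so it is conjugate to
  \<open>- u\<close> and has trace 0, which leaves no linear term in \<open>x * x\<close>.\<close>

lemma quadratic_traceless:
  assumes quad: "\<And>x. x * x \<in> span {1, x}" and x: "ntrace x = 0"
  shows "x * x \<in> scalars"
proof (cases "x \<in> scalars")
  case True
  then have "x = 0" using x by (rule traceless_scalar)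
  then show ?thesis using span_zero by simp
next
  case False
  obtain a b where ab: "x * x = a *s x + b *s 1" using quad span_1_iff by blast
  define u where "u = x - (a / 2) *s 1"
  have "(a / 2) *s x + (a / 2) *s x = a *s x" by (simp flip: scale_left_distrib)
  then have "u * u = x * x - a *s x + (a / 2 * (a / 2)) *s 1"
    by (simp add: u_def left_diff_distrib right_diff_distrib algebra_simps)
  then have "u * u = (b + a / 2 * (a / 2)) *s 1" by (simp add: ab scale_left_distrib)
  then have uu: "commutator (u * u) y = 0" for y by simp
  obtain y where "commutator x y \<noteq> 0" using False scalars_iff_central by blast
  then have z: "commutator u y \<noteq> 0" (is "?z \<noteq> 0") by (simp add: u_def)
  have "u * ?z + ?z * u = 0" using uu[of y] by (simp add: commutator_mult)
  then have "u * ?z = - (?z * u)" by (simp add: add_eq_0_iff2)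
  then have "u * ?z * inverse ?z = - (?z * u) * inverse ?z" by simp
  then have "u = - (?z * (u * inverse ?z))" using z by (simp add: mult.assoc)
  then have "ntrace u = - ntrace (?z * (u * inverse ?z))" by (metis ntrace_simps(6))
  also have "ntrace (?z * (u * inverse ?z)) = ntrace u"
    by (subst ntrace_mult_commute) (use z in \<open>simp add: mult.assoc\<close>)
  finally have "ntrace u = 0" by (simp add: eq_neg_iff_add_eq_0 flip: mult_2)
  then have "a = 0" using x by (simp add: u_def)
  then show ?thesis using ab scalars_iff by auto
qed

text \<open>Squares are controlled under \<open>\<theta>\<close> only for traceless elements and
  only modulo scalars. Projecting the anticommutator back to the traceless elements makes the rule
  exact: \<open>\<theta> (star x y) = \<alpha> *s star (\<theta> x) (\<theta> y)\<close>.\<close>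

definition star :: "'d \<Rightarrow> 'd \<Rightarrow> 'd"
  where "star x y = x * y + y * x - ntrace (x * y + y * x) *s 1"

lemma ntrace_star [simp]: "ntrace (star x y) = 0"
  by (simp add: star_def)

lemma star_simps:
  "star (x - y) z = star x z - star y z" "star z (x - y) = star z x - star z y"
  "star (a *s x) z = a *s star x z" "star x (a *s z) = a *s star x z"
  by (simp_all add: star_def algebra_simps scale_left_distrib scale_left_diff_distrib)

text \<open>For the full anticommutator the associator is exactly
  \<open>commutator y (commutator x z)\<close>. Removing the traces adds multiples of
  \<open>z\<close> and \<open>x\<close> and a scalar, and the scalar is 0 because both sides are
  traceless.\<close>

lemma star_associator:
  assumes "ntrace x = 0" "ntrace y = 0" "ntrace z = 0"
  shows "star (star x y) z - star x (star y z)
    = commutator y (commutator x z) - (2 * ntrace (x * y + y * x)) *s z + (2 * ntrace (y * z + z * y)) *s x"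
    (is "?l = ?r")
proof -
  have *: "(2 * a) *s v = a *s v + a *s v" for a v
    by (simp only: mult_2 scale_left_distrib)
  define n m where "n = ntrace (x * y + y * x)" and "m = ntrace (y * z + z * y)"
  have s: "star x y = x * y + y * x - n *s 1" "star y z = y * z + z * y - m *s 1"
    by (simp_all only: star_def n_def m_def)
  have "?l - ?r = (ntrace (x * star y z + star y z * x) - ntrace (star x y * z + z * star x y)) *s 1"
    unfolding star_def[of "star x y"] star_def[of x "star y z"] n_def[symmetric] m_def[symmetric] *
      scale_left_diff_distrib unfolding s commutator_def
    by (simp add: algebra_simps)
  then have "?l - ?r \<in> scalars" using scalars_iff by blast
  moreover have "ntrace (?l - ?r) = 0" using assms by simp
  ultimately show ?thesis using traceless_scalar by (metis eq_iff_diff_eq_0)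
qed

text \<open>Otherwise, comparing \<open>z\<close> with \<open>z + t * t\<close>, which has the same
  commutator with \<open>t\<close>, puts all double commutators into \<open>span {1, t}\<close>, so
  triple commutators with \<open>t\<close> vanish. The coefficient of that identity at
  \<open>t * t\<close> is \<open>t + (t + t)\<close> up to a scalar, which makes \<open>t\<close> a
  scalar.\<close>

lemma double_commutator_not_in_span:
  assumes t: "t * t \<notin> span {1, t}"
  shows "\<exists>z. commutator t (commutator t z) \<notin> span {z, 1, t}"
proof (rule ccontr)
  assume "\<not> ?thesis"
  then have "commutator t (commutator t z) \<in> span (insert z {1, t})" for z by blast
  then have ex: "\<exists>a. commutator t (commutator t z) - a *s z \<in> span {1, t}" for z
    unfolding span_insert[of _ "{1, t}"] by blast
  have comm: "commutator t u = 0" if "u \<in> span {1, t}" for u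
    using that by (auto simp: span_1_iff commutator_simps)
  have *: "commutator t (commutator t z) \<in> span {1, t}" for z
  proof (cases "commutator t z = 0")
    case True
    then show ?thesis using span_zero by (simp add: commutator_simps)
  next
    case False
    obtain a where a: "commutator t (commutator t z) - a *s z \<in> span {1, t}" using ex by blast
    obtain b where "commutator t (commutator t (z + t * t)) - b *s (z + t * t) \<in> span {1, t}" using ex by blast
    then have b: "commutator t (commutator t z) - b *s (z + t * t) \<in> span {1, t}"
      by (simp add: commutator_simps commutator_mult)
    have "(commutator t (commutator t z) - a *s z) - (commutator t (commutator t z) - b *s (z + t * t)) \<in> span {1, t}"
      using a b by (rule span_diff)
    then have d: "(b - a) *s z + b *s (t * t) \<in> span {1, t}"
      by (simp add: algebra_simps scale_left_diff_distrib scale_right_distrib)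
    then have "(b - a) *s commutator t z = 0"
      using comm[OF d] by (simp add: commutator_simps commutator_mult)
    then have "b = a" using False by simp
    then have "b *s (t * t) \<in> span {1, t}" using d by simp
    then have "inverse b *s (b *s (t * t)) \<in> span {1, t}" by (rule span_scale)
    then have "b = 0" using t by (cases "b = 0") auto
    then show ?thesis using b by simp
  qed
  have **: "commutator t (commutator t (commutator t y)) = 0" for y
    using comm[OF *] .
  obtain f where f: "functional f" "f (t * t) = 1" "\<And>y. y \<in> span {1, t} \<Longrightarrow> f y = 0"
    "\<And>ps. (\<And>y. (\<Sum>(a, b)\<leftarrow>ps. a * y * b) = 0) \<Longrightarrow> (\<Sum>(a, b)\<leftarrow>ps. f b *s a) = 0"
    using sandwich_coefficient[OF t] by blast
  have f1: "f 1 = 0" "f t = 0" by (rule f(3), simp add: span_base)+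
  have "(\<Sum>(a, b)\<leftarrow>[(t * t * t, 1), (- (t * t), t), (- (t * t), t), (- (t * t), t),
      (t, t * t), (t, t * t), (t, t * t), (- 1, t * t * t)]. f b *s a) = 0"
  proof (rule f(4))
    fix y
    show "(\<Sum>(a, b)\<leftarrow>[(t * t * t, 1), (- (t * t), t), (- (t * t), t), (- (t * t), t),
      (t, t * t), (t, t * t), (t, t * t), (- 1, t * t * t)]. a * y * b) = 0"
      using **[of y] by (simp add: commutator_def algebra_simps)
  qed
  then have "t + (t + t) = f (t * (t * t)) *s 1" using f(2) f1 by (simp add: algebra_simps)
  then have "commutator (t + (t + t)) y = 0" for y by simp
  then have "3 *s commutator t y = 0" for y
  proof -
    have "3 *s commutator t y = (1 + 1 + 1) *s commutator t y" by simp
    also have "\<dots> = commutator (t + (t + t)) y" by (simp only: scale_left_distrib scale_one commutator_simps add.assoc)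
    finally show ?thesis using \<open>\<And>y. commutator (t + (t + t)) y = 0\<close> by simp
  qed
  then have "t \<in> scalars" by (simp add: scalars_iff_central)
  then show False using span_1_square_not_in[OF t] by blast
qed

end

locale lie_automorphism = central_division_algebra scale Basis
  for scale :: "'k :: field_char_0 \<Rightarrow> 'd :: division_ring \<Rightarrow> 'd" (infixr \<open>*s\<close> 75) and Basis +
  fixes \<theta> :: "'d \<Rightarrow> 'd"
  assumes \<theta>_add: "\<theta> (x + y) = \<theta> x + \<theta> y"
    and \<theta>_scale: "\<theta> (a *s x) = a *s \<theta> x"
    and \<theta>_commutator: "\<theta> (commutator x y) = commutator (\<theta> x) (\<theta> y)"
    and \<theta>_1: "\<theta> 1 = 1"
    and \<theta>_bij: "bij \<theta>"
begin

lemma \<theta>_simps [simp]: "\<theta> (x + y) = \<theta> x + \<theta> y" "\<theta> (a *s x) = a *s \<theta> x" "\<theta> 0 = 0" "\<theta> 1 = 1"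
  "\<theta> (x - y) = \<theta> x - \<theta> y" "\<theta> (commutator x y) = commutator (\<theta> x) (\<theta> y)"
  using \<theta>_scale[of 0 0] \<theta>_add[of "x - y" y] by (simp_all add: \<theta>_add \<theta>_scale \<theta>_1 \<theta>_commutator algebra_simps)

lemma \<theta>_eq_iff [simp]: "\<theta> x = \<theta> y \<longleftrightarrow> x = y"
  using \<theta>_bij by (auto simp: bij_def inj_def)

lemma \<theta>_eq_0_iff [simp]: "\<theta> x = 0 \<longleftrightarrow> x = 0"
  using \<theta>_eq_iff[of x 0] by (simp del: \<theta>_eq_iff)

lemma \<theta>_obtain: obtains x where "y = \<theta> x"
  using \<theta>_bij by (auto simp: bij_def surj_def)

lemma ntrace_\<theta> [simp]: "ntrace (\<theta> x) = ntrace x"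
  using ntrace_unique[of "\<lambda>x. ntrace (\<theta> x)" x] by (simp add: functional_def)

text \<open>If \<open>u * u = c *s 1\<close>, the cube of the map \<open>commutator u\<close> is
  \<open>4 * c\<close> times that map. The scalar \<open>c\<close> is thus determined by the Lie
  structure, which \<open>\<theta>\<close> preserves.\<close>

lemma \<theta>_square_quadratic:
  assumes quad: "\<And>x. x * x \<in> span {1, x}" and x: "ntrace x = 0"
  shows "\<theta> (x * x) = \<theta> x * \<theta> x"
proof (cases "x = 0")
  case False
  obtain a b where a: "x * x = a *s 1" and b: "\<theta> x * \<theta> x = b *s 1"
    using quadratic_traceless[OF quad] x ntrace_\<theta>[of x] scalars_iff by metis
  have triple: "commutator u (commutator u (commutator u y)) = (4 * c) *s commutator u y"
    if "u * u = c *s 1" for u y c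
  proof -
    have *: "u * (u * w) = c *s w" for w
      using that by (metis mult.assoc mult_1 scale_mult_left)
    have "commutator u (commutator u (commutator u y))
        = c *s commutator u y + c *s commutator u y + c *s commutator u y + c *s commutator u y"
      by (simp add: commutator_def algebra_simps * that)
    also have "\<dots> = (c + c + c + c) *s commutator u y" by (simp only: scale_left_distrib)
    finally show ?thesis by simp
  qed
  have "x \<notin> scalars" using False x traceless_scalar by blast
  then obtain y where y: "commutator x y \<noteq> 0" using scalars_iff_central by blast
  have "\<theta> (commutator x (commutator x (commutator x y))) = (4 * a) *s commutator (\<theta> x) (\<theta> y)"
    unfolding triple[OF a] by simp
  moreover have "\<theta> (commutator x (commutator x (commutator x y))) = (4 * b) *s commutator (\<theta> x) (\<theta> y)"
    by (simp only: \<theta>_commutator triple[OF b])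
  ultimately have "(4 * a) *s commutator (\<theta> x) (\<theta> y) = (4 * b) *s commutator (\<theta> x) (\<theta> y)" by simp
  moreover have "commutator (\<theta> x) (\<theta> y) \<noteq> 0"
    using y \<theta>_eq_0_iff[of "commutator x y"] by (simp del: \<theta>_eq_0_iff)
  ultimately show ?thesis using a b by simp
qed simp

lemma \<theta>_square_generic:
  assumes t: "t * t \<notin> span {1, t}"
  shows "\<exists>\<alpha>. \<forall>x. ntrace x = 0 \<longrightarrow> \<theta> (x * x) - \<alpha> *s (\<theta> x * \<theta> x) \<in> scalars"
proof -
  define \<eta> where "\<eta> = inv_into UNIV \<theta>"
  have \<theta>\<eta> [simp]: "\<theta> (\<eta> x) = x" for x
    using \<theta>_bij by (simp add: \<eta>_def bij_def surj_f_inv_f)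
  have \<eta>: "\<eta> (x + y) = \<eta> x + \<eta> y" "\<eta> (a *s x) = a *s \<eta> x" "\<eta> (commutator x y) = commutator (\<eta> x) (\<eta> y)" for x y a
    by (subst \<theta>_eq_iff[symmetric], simp del: \<theta>_eq_iff)+
  define B where "B x y = (1 / 2) *s \<theta> (\<eta> x * \<eta> y + \<eta> y * \<eta> x)" for x y
  have half: "(1 / 2) *s (v + v) = v" for v
    by (simp add: scale_right_distrib flip: scale_left_distrib)
  have BB: "B x x = \<theta> (\<eta> x * \<eta> x)" for x
    by (simp only: B_def \<theta>_simps half)
  interpret B: commuting_bilinear scale Basis B
  proof
    fix x y z c
    show "B (x + y) z = B x z + B y z"
      by (simp add: B_def \<eta> scale_right_distrib algebra_simps)
    show "B (c *s x) z = c *s B x z"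
      by (simp add: B_def \<eta> scale_right_distrib mult.commute)
    show "B x y = B y x"
      by (simp add: B_def add.commute)
    have "commutator (B x x) x = \<theta> (commutator (\<eta> x * \<eta> x) (\<eta> x))"
      unfolding BB \<theta>_commutator by simp
    also have "\<dots> = 0" by (simp only: commutator_mult commutator_simps) simp
    finally show "commutator (B x x) x = 0" .
    have "commutator z (B x y) = (1 / 2) *s \<theta> (commutator (\<eta> z) (\<eta> x * \<eta> y + \<eta> y * \<eta> x))"
      unfolding \<theta>_commutator by (simp add: B_def)
    also have "\<dots> = B (commutator z x) y + B x (commutator z y)"
      by (simp only: B_def \<eta> commutator_mult commutator_simps \<theta>_simps) (simp add: scale_right_distrib algebra_simps)
    finally show "commutator z (B x y) = B (commutator z x) y + B x (commutator z y)" .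
  qed
  obtain \<alpha> \<kappa> where \<alpha>: "functional \<kappa>" "\<And>x y. \<kappa> (commutator x y) = 0"
    "\<And>y. B y y - \<alpha> *s (y * y) - \<kappa> y *s y \<in> scalars"
    using B.B_square_form[OF t] by blast
  have "\<theta> (x * x) - \<alpha> *s (\<theta> x * \<theta> x) \<in> scalars" if x: "ntrace x = 0" for x
  proof -
    have "\<kappa> (\<theta> x) = 0" using ntrace_unique[OF \<alpha>(1,2), of "\<theta> x"] x by simp
    moreover have "\<eta> (\<theta> x) = x" using \<theta>_bij by (simp add: \<eta>_def bij_def)
    ultimately show ?thesis using \<alpha>(3)[of "\<theta> x"] by (simp add: BB)
  qed
  then show ?thesis by blast
qed

lemma \<theta>_square:
  "\<exists>\<epsilon>. \<epsilon> * \<epsilon> = 1 \<and> (\<forall>x. ntrace x = 0 \<longrightarrow>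
    \<theta> (x * x) = \<epsilon> *s (\<theta> x * \<theta> x) + ((1 - \<epsilon>) * ntrace (x * x)) *s 1)"
proof (cases "\<forall>t. t * t \<in> span {1, t}")
  case True
  then show ?thesis using \<theta>_square_quadratic by (intro exI[of _ 1]) simp
next
  case False
  then obtain t where t: "t * t \<notin> span {1, t}" by blast
  obtain \<alpha> where \<alpha>: "\<And>x. ntrace x = 0 \<Longrightarrow> \<theta> (x * x) - \<alpha> *s (\<theta> x * \<theta> x) \<in> scalars"
    using \<theta>_square_generic[OF t] by blast
  have \<theta>_star: "\<theta> (star x y) = \<alpha> *s star (\<theta> x) (\<theta> y)" if "ntrace x = 0" "ntrace y = 0" for x y
  proof -
    have "(\<theta> ((x + y) * (x + y)) - \<alpha> *s (\<theta> (x + y) * \<theta> (x + y))) - (\<theta> (x * x) - \<alpha> *s (\<theta> x * \<theta> x))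
        - (\<theta> (y * y) - \<alpha> *s (\<theta> y * \<theta> y)) \<in> scalars" (is "?d \<in> _")
      using \<alpha> that by (intro span_diff \<alpha>) simp_all
    moreover have "\<theta> (star x y) - \<alpha> *s star (\<theta> x) (\<theta> y) = ?d
        - (ntrace (x * y + y * x) - \<alpha> * ntrace (\<theta> x * \<theta> y + \<theta> y * \<theta> x)) *s 1"
      unfolding star_def scale_left_diff_distrib
      by (simp add: distrib_left distrib_right scale_right_distrib scale_right_diff_distrib)
    ultimately have "\<theta> (star x y) - \<alpha> *s star (\<theta> x) (\<theta> y) \<in> scalars"
      by (simp only: span_diff span_scale span_base insertI1)
    then show ?thesis using traceless_scalar[of "\<theta> (star x y) - \<alpha> *s star (\<theta> x) (\<theta> y)"] by simp
  qed
  define n where "n x y = ntrace (x * y + y * x)" for x y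
  \<comment> \<open>Under \<open>\<theta>\<close> the associator of \<open>star\<close> acquires the
    factor \<open>\<alpha> * \<alpha>\<close>, whereas the double commutator in
    \<open>star_associator\<close> is simply transported; \<open>key\<close> is the
    discrepancy.\<close>
  have key: "(\<alpha> * \<alpha> - 1) *s commutator (\<theta> y) (commutator (\<theta> x) (\<theta> z))
      = (2 * (\<alpha> * \<alpha> * n (\<theta> x) (\<theta> y) - n x y)) *s \<theta> z - (2 * (\<alpha> * \<alpha> * n (\<theta> y) (\<theta> z) - n y z)) *s \<theta> x"
    if tr: "ntrace x = 0" "ntrace y = 0" "ntrace z = 0" for x y z
  proof -
    have "\<theta> (star (star x y) z - star x (star y z))
        = (\<alpha> * \<alpha>) *s (star (star (\<theta> x) (\<theta> y)) (\<theta> z) - star (\<theta> x) (star (\<theta> y) (\<theta> z)))"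
      using tr by (simp add: \<theta>_star star_simps scale_right_diff_distrib)
    also have "star (star (\<theta> x) (\<theta> y)) (\<theta> z) - star (\<theta> x) (star (\<theta> y) (\<theta> z))
        = commutator (\<theta> y) (commutator (\<theta> x) (\<theta> z)) - (2 * n (\<theta> x) (\<theta> y)) *s \<theta> z + (2 * n (\<theta> y) (\<theta> z)) *s \<theta> x"
      using tr by (simp add: star_associator n_def)
    also have "\<theta> (star (star x y) z - star x (star y z))
        = commutator (\<theta> y) (commutator (\<theta> x) (\<theta> z)) - (2 * n x y) *s \<theta> z + (2 * n y z) *s \<theta> x"
      using tr by (simp add: star_associator n_def del: ntrace_simps)
    finally show ?thesis
      by (simp add: scale_right_distrib scale_right_diff_distrib scale_left_diff_distrib
          right_diff_distrib algebra_simps)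
  qed
  \<comment> \<open>Otherwise \<open>key\<close> puts every double commutator of traceless elements
    into the span of its two inner arguments. With the traceless part of \<open>t\<close> in both
    the outer and the first inner place, this contradicts
    \<open>double_commutator_not_in_span\<close>.\<close>
  have \<alpha>1: "\<alpha> * \<alpha> = 1"
  proof (rule ccontr)
    assume "\<alpha> * \<alpha> \<noteq> 1"
    then have a: "\<alpha> * \<alpha> - 1 \<noteq> 0" by simp
    have span: "commutator y (commutator x z) \<in> span {x, z}"
      if "ntrace x = 0" "ntrace y = 0" "ntrace z = 0" for x y z
    proof -
      obtain x' y' z' where xyz: "x = \<theta> x'" "y = \<theta> y'" "z = \<theta> z'" by (metis \<theta>_obtain)
      then have "(\<alpha> * \<alpha> - 1) *s commutator y (commutator x z) \<in> span {x, z}"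
        using that unfolding xyz by (subst key) (simp_all add: span_diff span_scale span_base)
      then have "inverse (\<alpha> * \<alpha> - 1) *s ((\<alpha> * \<alpha> - 1) *s commutator y (commutator x z)) \<in> span {x, z}"
        by (rule span_scale)
      then show ?thesis using a by simp
    qed
    have "commutator t (commutator t z) \<in> span {z, 1, t}" for z
    proof -
      have "commutator (t - ntrace t *s 1) (commutator (t - ntrace t *s 1) (z - ntrace z *s 1))
          \<in> span {t - ntrace t *s 1, z - ntrace z *s 1}"
        by (rule span) simp_all
      also have "\<dots> \<subseteq> span {z, 1, t}"
      proof (rule span_minimal)
        have "t - ntrace t *s 1 \<in> span {z, 1, t}" "z - ntrace z *s 1 \<in> span {z, 1, t}"
          by (intro span_diff span_scale; simp add: span_base)+
        then show "{t - ntrace t *s 1, z - ntrace z *s 1} \<subseteq> span {z, 1, t}" by simp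
      qed simp
      finally show ?thesis by simp
    qed
    then show False using double_commutator_not_in_span[OF t] by blast
  qed
  \<comment> \<open>The left side of \<open>key\<close> is now 0, and a traceless \<open>z\<close>
    independent of \<open>x\<close> makes the coefficient of \<open>\<theta> z\<close> vanish. So
    \<open>\<theta>\<close> preserves the trace form, which fixes the scalar part of
    \<open>\<theta> (x * x)\<close>.\<close>
  have n: "n (\<theta> x) (\<theta> y) = n x y" if tr: "ntrace x = 0" "ntrace y = 0" for x y
  proof (cases "x = 0")
    case False
    have "\<exists>z. ntrace z = 0 \<and> z \<notin> span {x}"
    proof (rule ccontr)
      assume *: "\<not> ?thesis"
      have "commutator u v = 0" for u v :: 'd
      proof -
        have "\<exists>a. u - ntrace u *s 1 = a *s x" for u :: 'd
          using * by (force simp: span_singleton)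
        then obtain a b where "u - ntrace u *s 1 = a *s x" "v - ntrace v *s 1 = b *s x" by metis
        then have "commutator (u - ntrace u *s 1) (v - ntrace v *s 1) = 0" by (simp add: commutator_simps)
        then show ?thesis by simp
      qed
      then show False using span_1_square_not_in[OF t] scalars_iff_central by blast
    qed
    then obtain z where z: "ntrace z = 0" "z \<notin> span {x}" by blast
    define d e where "d = 2 * (n (\<theta> x) (\<theta> y) - n x y)" and "e = 2 * (n (\<theta> y) (\<theta> z) - n y z)"
    have "\<theta> (d *s z) = \<theta> (e *s x)"
      using key[OF tr z(1)] by (simp add: \<alpha>1 d_def e_def del: \<theta>_eq_iff)
    then have "d *s z = e *s x" by (simp only: \<theta>_eq_iff)
    then have "d = 0"
      using z(2) by (metis span_singleton rangeI scale_scale left_inverse scale_one)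
    then show ?thesis by (simp add: d_def)
  qed (simp add: n_def)
  have "\<theta> (x * x) = \<alpha> *s (\<theta> x * \<theta> x) + ((1 - \<alpha>) * ntrace (x * x)) *s 1" if x: "ntrace x = 0" for x
  proof -
    have "ntrace (\<theta> x * \<theta> x) + ntrace (\<theta> x * \<theta> x) = ntrace (x * x) + ntrace (x * x)"
      using n[OF x x] by (simp only: n_def ntrace_simps(1))
    then have "2 * ntrace (\<theta> x * \<theta> x) = 2 * ntrace (x * x)" by (simp only: mult_2)
    then have m: "ntrace (\<theta> x * \<theta> x) = ntrace (x * x)" by simp
    have star: "star v v = v * v + v * v - (ntrace (v * v) *s 1 + ntrace (v * v) *s 1)" for v
      by (simp only: star_def ntrace_simps(1) scale_left_distrib)
    have "\<theta> (star x x) = \<alpha> *s star (\<theta> x) (\<theta> x)" using x x by (rule \<theta>_star)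
    then have "\<theta> (x * x) + \<theta> (x * x) = (\<alpha> *s (\<theta> x * \<theta> x) + ((1 - \<alpha>) * ntrace (x * x)) *s 1)
        + (\<alpha> *s (\<theta> x * \<theta> x) + ((1 - \<alpha>) * ntrace (x * x)) *s 1)"
      unfolding star m by (simp add: scale_right_distrib scale_right_diff_distrib
          scale_left_diff_distrib left_diff_distrib algebra_simps)
    then show ?thesis by (simp only: double_eq_iff)
  qed
  then show ?thesis using \<alpha>1 by blast
qed

text \<open>Twisting by the sign \<open>\<epsilon>\<close> on the traceless part turns \<open>\<theta>\<close> into a Jordan automorphism.\<close>

lemma jordan_twist:
  "\<exists>\<epsilon>. \<epsilon> * \<epsilon> = 1 \<and> (\<forall>x. let \<psi> = \<lambda>x. \<epsilon> *s \<theta> x + ((1 - \<epsilon>) * ntrace x) *s 1 in \<forall>m. \<psi> (x ^ m) = \<psi> x ^ m)"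
proof -
  obtain \<epsilon> where \<epsilon>: "\<epsilon> * \<epsilon> = 1"
    "\<And>x. ntrace x = 0 \<Longrightarrow> \<theta> (x * x) = \<epsilon> *s (\<theta> x * \<theta> x) + ((1 - \<epsilon>) * ntrace (x * x)) *s 1"
    using \<theta>_square by blast
  define \<psi> where "\<psi> x = \<epsilon> *s \<theta> x + ((1 - \<epsilon>) * ntrace x) *s 1" for x
  have lin: "\<psi> (x + y) = \<psi> x + \<psi> y" "\<psi> (a *s x) = a *s \<psi> x" "\<psi> 1 = 1" for x y a
    by (simp_all add: \<psi>_def scale_right_distrib distrib_left scale_left_distrib mult_ac
        flip: scale_left_distrib)
  have sq0: "\<psi> (x * x) = \<psi> x * \<psi> x" if x: "ntrace x = 0" for x
  proof -
    have "\<psi> x * \<psi> x = \<theta> x * \<theta> x" using x \<epsilon>(1) by (simp add: \<psi>_def)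
    moreover have "\<psi> (x * x) = \<theta> x * \<theta> x + ((\<epsilon> * (1 - \<epsilon>)) * ntrace (x * x) + (1 - \<epsilon>) * ntrace (x * x)) *s 1"
      using \<epsilon>(1) by (simp add: \<psi>_def \<epsilon>(2)[OF x] scale_right_distrib scale_left_distrib mult.assoc)
    moreover have "(\<epsilon> * (1 - \<epsilon>)) * ntrace (x * x) + (1 - \<epsilon>) * ntrace (x * x) = 0"
      using \<epsilon>(1) by (simp add: algebra_simps)
    ultimately show ?thesis by simp
  qed
  have sq: "\<psi> (x * x) = \<psi> x * \<psi> x" for x
  proof -
    define a y where "a = ntrace x" and "y = x - a *s 1"
    have y: "ntrace y = 0" "x = y + a *s 1" by (simp_all add: y_def a_def)
    show ?thesis
      unfolding y(2) by (simp add: lin sq0[OF y(1)] distrib_left distrib_right)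
  qed
  have jordan: "\<psi> (x * y + y * x) = \<psi> x * \<psi> y + \<psi> y * \<psi> x" for x y
    using sq[of "x + y"] by (simp add: lin sq distrib_left distrib_right algebra_simps)
  have "\<psi> (x ^ m) = \<psi> x ^ m" for x m
  proof (induction m)
    case (Suc m)
    have "\<psi> (x ^ Suc m + x ^ Suc m) = \<psi> (x * x ^ m + x ^ m * x)" by (simp add: power_commutes)
    also have "\<dots> = \<psi> x ^ Suc m + \<psi> x ^ Suc m" by (simp only: jordan Suc.IH) (simp add: power_commutes)
    finally show ?case by (simp only: lin double_eq_iff)
  qed (simp add: lin)
  then show ?thesis using \<epsilon>(1) unfolding \<psi>_def by (intro exI[of _ \<epsilon>]) simp
qed

end

section \<open>Orders over the \<open>p\<close>-adic integers\<close>

lemma int_cut: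
  fixes P :: "int \<Rightarrow> bool"
  assumes "P a" "\<not> P b" and down: "\<And>i j. P j \<Longrightarrow> i \<le> j \<Longrightarrow> P i"
  shows "\<exists>k. \<forall>j. P j \<longleftrightarrow> j \<le> k"
proof -
  define k where "k = Max {j \<in> {a..b}. P j}"
  have "a \<le> b" using assms by (meson linorder_le_cases)
  then have ne: "{j \<in> {a..b}. P j} \<noteq> {}" using assms(1) by auto
  have fin: "finite {j \<in> {a..b}. P j}" by (rule finite_subset[of _ "{a..b}"]) auto
  have k: "k \<in> {j \<in> {a..b}. P j}" unfolding k_def using fin ne by (rule Max_in)
  have "j \<le> k" if "P j" for j
  proof (cases "a \<le> j")
    case True
    have "j \<le> b" using that assms(2) down by (meson linorder_le_cases)
    then show ?thesis unfolding k_def using True that fin by (intro Max_ge) auto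
  qed (use k in auto)
  then show ?thesis using k down by blast
qed

abbreviation padic_of_int :: "'p :: prime_card padic_int \<Rightarrow> 'p padic"
  where "padic_of_int a \<equiv> Fract a 1"

abbreviation uniformizer :: "'p :: prime_card padic"
  where "uniformizer \<equiv> of_nat CARD('p)"

lemma uniformizer_nz [simp]: "(uniformizer :: 'p :: prime_card padic) \<noteq> 0"
  using card_prime_card_gt_1[where 'p = 'p] by simp

lemma padic_of_int_power: "padic_of_int (of_nat CARD('p :: prime_card) ^ n) = (uniformizer :: 'p padic) ^ n"
  by (metis Fract_of_nat_eq of_nat_power)

lemma padic_integral_multiple:
  "\<exists>n a. uniformizer ^ n * c = padic_of_int (a :: 'p :: prime_card padic_int)"
proof (cases c)
  case (Fract a b)
  then obtain n where "b dvd of_nat CARD('p) ^ n" using padic_int_dvd_power by blast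
  then obtain d where d: "of_nat CARD('p) ^ n = b * d" by (auto simp: dvd_def)
  have "uniformizer ^ n * c = padic_of_int (a * d)"
    unfolding padic_of_int_power[symmetric] Fract(1) d using Fract(2) by (simp add: eq_fract mult_ac)
  then show ?thesis by blast
qed

locale padic_order = central_division_algebra scale Basis
  for scale :: "'p :: prime_card padic \<Rightarrow> 'd :: division_ring \<Rightarrow> 'd" (infixr \<open>*s\<close> 75) and Basis +
  fixes \<Delta> :: "'d set"
  assumes order: "zp_order scale \<Delta>"
begin

sublocale Z: Modules.module "zp_scale scale"
  by (rule zp_scale_module) (rule vector_space_axioms)

abbreviation \<pi> :: "'p padic" where "\<pi> \<equiv> uniformizer"

lemma one_in_order: "1 \<in> \<Delta>" and order_mult: "x \<in> \<Delta> \<Longrightarrow> y \<in> \<Delta> \<Longrightarrow> x * y \<in> \<Delta>"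
  and order_span: "span \<Delta> = UNIV"
  using order by (auto simp: zp_order_def)

definition gens :: "'d set"
  where "gens = (SOME G. finite G \<and> \<Delta> = Z.span G)"

lemma gens: "finite gens" "Z.span gens = \<Delta>"
proof -
  have "\<exists>G. finite G \<and> \<Delta> = Z.span G" using order unfolding zp_order_def by blast
  then have *: "finite gens \<and> \<Delta> = Z.span gens" unfolding gens_def by (rule someI_ex)
  show "finite gens" using * by (rule conjunct1)
  show "Z.span gens = \<Delta>" using * by (rule conjunct2[THEN sym])
qed

lemma order_subspace: "Z.subspace \<Delta>"
  using Z.subspace_span[of gens] by (simp only: gens(2))

lemma gens_in_order: "b \<in> gens \<Longrightarrow> b \<in> \<Delta>"
  using Z.span_base[of b gens] by (simp only: gens(2))

lemmas order_closed = Z.subspace_0[OF order_subspace] Z.subspace_add[OF order_subspace]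
  Z.subspace_diff[OF order_subspace] Z.subspace_neg[OF order_subspace] Z.subspace_sum[OF order_subspace]

lemma order_scale: "x \<in> \<Delta> \<Longrightarrow> padic_of_int a *s x \<in> \<Delta>"
  using Z.subspace_scale[OF order_subspace, of x a] by (simp add: zp_scale_def)

lemma order_uniformizer: "x \<in> \<Delta> \<Longrightarrow> \<pi> ^ n *s x \<in> \<Delta>"
  using order_scale[of x "of_nat CARD('p) ^ n"] by (simp add: padic_of_int_power)

lemma order_coordinates:
  assumes "x \<in> \<Delta>" shows "\<exists>u. x = (\<Sum>b\<in>gens. padic_of_int (u b) *s b)"
proof -
  have "x \<in> Z.span gens" using assms by (simp only: gens(2))
  then show ?thesis unfolding Z.span_finite[OF gens(1)] zp_scale_def by blast
qed

lemma order_combination: "(\<Sum>b\<in>gens. padic_of_int (u b) *s b) \<in> \<Delta>"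
  by (intro order_closed(5) order_scale gens_in_order)

text \<open>This is \<open>\<pi> powi k\<close> times \<open>\<Delta>\<close>. Stated as a preimage,
  membership is a condition on \<open>x\<close> alone, for negative \<open>k\<close> as
  well.\<close>

definition layer :: "int \<Rightarrow> 'd set"
  where "layer k = {x. \<pi> powi (-k) *s x \<in> \<Delta>}"

lemma layer_0 [simp]: "layer 0 = \<Delta>"
  by (simp add: layer_def)

lemma layer_subspace: "Z.subspace (layer k)"
proof (rule Z.subspaceI)
  show "0 \<in> layer k" using order_closed(1) by (simp add: layer_def)
  show "x + y \<in> layer k" if "x \<in> layer k" "y \<in> layer k" for x y
    using that order_closed(2) by (simp add: layer_def scale_right_distrib)
  show "zp_scale scale c x \<in> layer k" if "x \<in> layer k" for c x
    using that order_scale[of "\<pi> powi (-k) *s x" c] by (simp add: layer_def zp_scale_def mult.commute)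
qed

lemmas layer_closed = Z.subspace_0[OF layer_subspace] Z.subspace_add[OF layer_subspace]
  Z.subspace_diff[OF layer_subspace] Z.subspace_neg[OF layer_subspace] Z.subspace_sum[OF layer_subspace]

lemma layer_scale: "x \<in> layer k \<Longrightarrow> padic_of_int a *s x \<in> layer k"
  using Z.subspace_scale[OF layer_subspace, of x k a] by (simp add: zp_scale_def)

lemma layer_antimono: "i \<le> j \<Longrightarrow> layer j \<subseteq> layer i"
proof
  fix x assume "i \<le> j" "x \<in> layer j"
  then have "\<pi> ^ nat (j - i) *s \<pi> powi (-j) *s x \<in> \<Delta>"
    by (intro order_uniformizer) (simp add: layer_def)
  also have "\<pi> ^ nat (j - i) *s \<pi> powi (-j) *s x = \<pi> powi ((j - i) + - j) *s x"
    using \<open>i \<le> j\<close> by (subst power_int_add) (simp_all add: power_int_def)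
  finally show "x \<in> layer i" by (simp add: layer_def)
qed

lemma layer_mult: "x \<in> layer i \<Longrightarrow> y \<in> layer j \<Longrightarrow> x * y \<in> layer (i + j)"
  using order_mult[of "\<pi> powi (-i) *s x" "\<pi> powi (-j) *s y"]
  by (simp add: layer_def power_int_add power_int_minus_mult mult_ac flip: minus_add_distrib)
     (metis add.inverse_distrib_swap mult.commute power_int_add uniformizer_nz minus_add_distrib)

lemma layer_shift: "\<pi> powi j *s x \<in> layer k \<longleftrightarrow> x \<in> layer (k - j)"
proof -
  have "\<pi> powi (- k) * \<pi> powi j = \<pi> powi (- (k - j))" by (subst power_int_add[symmetric]) simp_all
  then show ?thesis by (simp add: layer_def)
qed

lemma layer_shift_nat: "\<pi> ^ n *s x \<in> layer k \<longleftrightarrow> x \<in> layer (k - int n)"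
  using layer_shift[of "int n" x k] by simp

lemma layer_exhaust: "\<exists>n. x \<in> layer (- int n)"
proof -
  have "x \<in> span \<Delta>" by (simp add: order_span)
  then show ?thesis
  proof (induction rule: span_induct_alt)
    case base
    then show ?case using layer_closed(1) by blast
  next
    case (step c u y)
    obtain n where n: "y \<in> layer (- int n)" using step by blast
    obtain m a where m: "\<pi> ^ m * c = padic_of_int a" using padic_integral_multiple by blast
    have "\<pi> ^ m *s c *s u \<in> layer 0" using order_scale[OF step(1), of a] by (simp add: m)
    then have "c *s u \<in> layer (- int m)" by (simp only: layer_shift_nat) simp
    then have "c *s u \<in> layer (- int (m + n))" "y \<in> layer (- int (m + n))"
      using n layer_antimono[of "- int (m + n)"] by (meson subsetD le_imp_neg_le of_nat_mono le_add1 le_add2)+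
    then show ?case using layer_closed(2) by blast
  qed
qed

lemma layer_exhaust_finite:
  assumes "finite A" shows "\<exists>n. A \<subseteq> layer (- int n)"
  using assms
proof induction
  case (insert x A)
  obtain n m where "A \<subseteq> layer (- int n)" "x \<in> layer (- int m)" using insert.IH layer_exhaust by blast
  then have "insert x A \<subseteq> layer (- int (max n m))"
    using layer_antimono[of "- int (max n m)" "- int n"] layer_antimono[of "- int (max n m)" "- int m"] by auto
  then show ?case by blast
qed simp

text \<open>Since \<open>gens\<close> is finite, the coordinates of all elements of
  \<open>\<Delta>\<close> in \<open>Basis\<close> have a common denominator
  \<open>\<pi> ^ N\<close>. After multiplication by it, the coordinates of \<open>x\<close> are
  \<open>p\<close>-adic integers divisible by every power of \<open>p\<close>.\<close>

lemma layer_separated: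
  assumes x: "\<And>n. x \<in> layer (int n)"
  shows "x = 0"
proof -
  let ?r = "representation Basis" and ?I = "range padic_of_int :: 'p padic set"
  have I: "a + b \<in> ?I" "a * b \<in> ?I" if "a \<in> ?I" "b \<in> ?I" for a b using that by auto
  have I0: "\<pi> ^ n \<in> ?I" for n by (metis padic_of_int_power rangeI)
  have Isum: "sum f A \<in> ?I" if "\<And>a. a \<in> A \<Longrightarrow> f a \<in> ?I" for f and A :: "'d set"
    using that
  proof (induction A rule: infinite_finite_induct)
    case (insert a A)
    then show ?case using I(1)[of "f a" "sum f A"] by simp
  qed (auto intro: range_eqI[of _ _ 0] simp: Zero_fract_def)
  have "\<exists>N. \<forall>be\<in>A. \<pi> ^ N * ?r (fst be) (snd be) \<in> ?I" if "finite A" for A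
    using that
  proof induction
    case (insert be A)
    obtain N where N: "\<forall>be\<in>A. \<pi> ^ N * ?r (fst be) (snd be) \<in> ?I" using insert.IH by blast
    obtain M a where M: "\<pi> ^ M * ?r (fst be) (snd be) = padic_of_int a" using padic_integral_multiple by blast
    have "\<pi> ^ (N + M) * ?r (fst b) (snd b) \<in> ?I" if "b \<in> insert be A" for b
    proof (cases "b = be")
      case True
      have "\<pi> ^ N * (\<pi> ^ M * ?r (fst be) (snd be)) \<in> ?I" unfolding M using I0 by (intro I(2)) auto
      then show ?thesis using True by (simp add: power_add mult.assoc)
    next
      case False
      then have "\<pi> ^ N * ?r (fst b) (snd b) \<in> ?I" using N that by blast
      then have "\<pi> ^ M * (\<pi> ^ N * ?r (fst b) (snd b)) \<in> ?I" by (rule I(2)[OF I0])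
      then show ?thesis by (simp add: power_add mult_ac)
    qed
    then show ?case by blast
  qed simp
  from this[of "gens \<times> Basis"] obtain N
    where N: "\<And>b e. b \<in> gens \<Longrightarrow> e \<in> Basis \<Longrightarrow> \<pi> ^ N * ?r b e \<in> ?I"
    using gens(1) finite_Basis by auto
  have N: "\<pi> ^ N * ?r y e \<in> ?I" if "y \<in> \<Delta>" "e \<in> Basis" for y e
  proof -
    from order_coordinates[OF that(1)] obtain u where u: "y = (\<Sum>b\<in>gens. padic_of_int (u b) *s b)" by blast
    have "\<pi> ^ N * ?r y e = (\<Sum>b\<in>gens. padic_of_int (u b) * (\<pi> ^ N * ?r b e))"
      unfolding u by (simp add: representation_sum representation_scale independent_Basis span_Basis
          sum_distrib_left mult_ac)
    also have "\<dots> \<in> ?I" by (rule Isum) (rule I(2)[OF rangeI N[OF _ that(2)]])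
    finally show ?thesis .
  qed
  have "?r x e = 0" if e: "e \<in> Basis" for e
  proof -
    obtain a where a: "\<pi> ^ N * ?r x e = padic_of_int a"
      using N[of x e] x[of 0] e by auto
    have "Rep_padic_int a n = 0" for n
    proof -
      have "\<pi> powi (- int n) *s x \<in> \<Delta>" using x[of n] by (simp add: layer_def)
      from N[OF this e] obtain b where "\<pi> ^ N * ?r (\<pi> powi (- int n) *s x) e = padic_of_int b" by auto
      then have "\<pi> powi (- int n) * (\<pi> ^ N * ?r x e) = padic_of_int b"
        by (simp add: representation_scale independent_Basis span_Basis mult_ac)
      then have "padic_of_int a = \<pi> ^ n * padic_of_int b"
        unfolding a by (simp add: power_int_minus field_simps)
      then have "padic_of_int a = padic_of_int (of_nat CARD('p) ^ n * b)"
        by (simp flip: padic_of_int_power)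
      then have "a = of_nat CARD('p) ^ n * b" by (simp add: eq_fract)
      then show ?thesis using padic_int_dvd_iff[of n a] by simp
    qed
    then have "Rep_padic_int a = Rep_padic_int (0 :: 'p padic_int)" by (auto simp: zero_padic_int.rep_eq)
    then have "a = 0" by (simp only: Rep_padic_int_inject)
    then show ?thesis using a by (simp flip: Zero_fract_def)
  qed
  moreover have "(\<Sum>e\<in>Basis. ?r x e *s e) = x"
    by (intro sum_representation_eq) (auto simp: independent_Basis span_Basis finite_Basis)
  ultimately show ?thesis by simp
qed

lemma order_finite_residues:
  "\<exists>R. finite R \<and> (\<forall>x\<in>\<Delta>. \<exists>r\<in>R. x - r \<in> layer (int n))"
proof -
  define c where "c m = (\<Sum>b\<in>gens. padic_of_int (of_nat (m b)) *s b)" for m :: "'d \<Rightarrow> nat"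
  define R where "R = c ` (gens \<rightarrow>\<^sub>E {..<CARD('p) ^ n})"
  have "finite R" unfolding R_def using gens(1) by (intro finite_imageI finite_PiE) auto
  moreover have "\<exists>r\<in>R. x - r \<in> layer (int n)" if "x \<in> \<Delta>" for x
  proof -
    from order_coordinates[OF that] obtain u where u: "x = (\<Sum>b\<in>gens. padic_of_int (u b) *s b)" by blast
    define m where "m = restrict (\<lambda>b. nat (Rep_padic_int (u b) n)) gens"
    have "nat (Rep_padic_int (u b) n) < CARD('p) ^ n" for b
      using padic_int_Rep_range[of "u b" n] by (simp add: nat_less_iff)
    then have "c m \<in> R" unfolding R_def by (intro imageI) (auto simp: m_def)
    moreover have "x - c m \<in> layer (int n)"
    proof -
      have "x - c m = (\<Sum>b\<in>gens. padic_of_int (u b - of_nat (nat (Rep_padic_int (u b) n))) *s b)"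
        unfolding u c_def sum_subtractf[symmetric]
        by (intro sum.cong refl) (simp add: m_def flip: scale_left_diff_distrib)
      also have "\<dots> \<in> layer (int n)"
      proof (rule layer_closed(5))
        fix b assume b: "b \<in> gens"
        obtain w where w: "u b - of_nat (nat (Rep_padic_int (u b) n)) = of_nat CARD('p) ^ n * w"
          using padic_int_nat_approx[of n "u b"] by (auto simp: dvd_def)
        have "\<pi> ^ n *s padic_of_int w *s b \<in> layer (int n)"
          unfolding layer_shift_nat using order_scale[OF gens_in_order[OF b]] by simp
        then show "padic_of_int (u b - of_nat (nat (Rep_padic_int (u b) n))) *s b \<in> layer (int n)"
          unfolding w by (simp flip: padic_of_int_power)
      qed
      finally show ?thesis .
    qed
    ultimately show ?thesis by blast
  qed
  ultimately show ?thesis by blast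
qed

text \<open>Compactness of \<open>\<Delta>\<close> and the absence of zero divisors bound the defect of multiplicativity.\<close>

lemma order_mult_bound:
  "\<exists>m::nat. \<forall>x\<in>\<Delta> - layer 1. \<forall>y\<in>\<Delta> - layer 1. x * y \<notin> layer (int m)"
proof (rule ccontr)
  assume "\<not> ?thesis"
  then have "\<forall>m. \<exists>x y. x \<in> \<Delta> - layer 1 \<and> y \<in> \<Delta> - layer 1 \<and> x * y \<in> layer (int m)" by blast
  then obtain xs ys where xys: "\<And>m::nat. xs m \<in> \<Delta> - layer 1" "\<And>m. ys m \<in> \<Delta> - layer 1"
    "\<And>m. xs m * ys m \<in> layer (int m)" by metis
  have "\<forall>m. \<exists>u. xs m = (\<Sum>b\<in>gens. padic_of_int (u b) *s b)"
    using xys(1) by (intro allI order_coordinates) simp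
  from choice[OF this] obtain U where U: "\<forall>m. xs m = (\<Sum>b\<in>gens. padic_of_int (U m b) *s b)" ..
  have "\<forall>m. \<exists>u. ys m = (\<Sum>b\<in>gens. padic_of_int (u b) *s b)"
    using xys(2) by (intro allI order_coordinates) simp
  from choice[OF this] obtain W where W: "\<forall>m. ys m = (\<Sum>b\<in>gens. padic_of_int (W m b) *s b)" ..
  \<comment> \<open>The disjoint sum of two copies of \<open>gens\<close> lets one cluster point
    serve both sequences at the same indices.\<close>
  obtain a where a: "\<forall>n. \<exists>m\<ge>n. \<forall>b\<in>Sum_Type.Plus gens gens. of_nat CARD('p) ^ n dvd case_sum (U m) (W m) b - a b"
    using padic_int_cluster_point[of "Sum_Type.Plus gens gens" "\<lambda>m. case_sum (U m) (W m)"] gens(1) by auto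
  define x y where "x = (\<Sum>b\<in>gens. padic_of_int (a (Inl b)) *s b)"
    and "y = (\<Sum>b\<in>gens. padic_of_int (a (Inr b)) *s b)"
  have close: "(\<Sum>b\<in>gens. padic_of_int (u b) *s b) - (\<Sum>b\<in>gens. padic_of_int (w b) *s b) \<in> layer (int n)"
    if "\<And>b. b \<in> gens \<Longrightarrow> of_nat CARD('p) ^ n dvd u b - w b" for u w n
  proof -
    have "padic_of_int (u b) *s b - padic_of_int (w b) *s b \<in> layer (int n)" if b: "b \<in> gens" for b
    proof -
      obtain v where v: "u b - w b = of_nat CARD('p) ^ n * v"
        using \<open>\<And>b. b \<in> gens \<Longrightarrow> of_nat CARD('p) ^ n dvd u b - w b\<close>[OF b] by (auto simp: dvd_def)
      have "\<pi> ^ n *s padic_of_int v *s b \<in> layer (int n)"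
        unfolding layer_shift_nat using order_scale[OF gens_in_order[OF b]] by simp
      moreover have "padic_of_int (u b) *s b - padic_of_int (w b) *s b = padic_of_int (u b - w b) *s b"
        by (simp flip: scale_left_diff_distrib)
      ultimately show ?thesis unfolding v by (simp flip: padic_of_int_power)
    qed
    then show ?thesis unfolding sum_subtractf[symmetric] by (rule layer_closed(5))
  qed
  have approx: "\<exists>m\<ge>n. xs m - x \<in> layer (int n) \<and> ys m - y \<in> layer (int n)" for n
  proof -
    obtain m where m: "m \<ge> n" "\<forall>b\<in>Sum_Type.Plus gens gens. of_nat CARD('p) ^ n dvd case_sum (U m) (W m) b - a b"
      using a by blast
    then have d: "of_nat CARD('p) ^ n dvd U m b - a (Inl b)" "of_nat CARD('p) ^ n dvd W m b - a (Inr b)"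
      if "b \<in> gens" for b
      using that by force+
    have "xs m - x \<in> layer (int n)" "ys m - y \<in> layer (int n)"
      unfolding U[rule_format] W[rule_format] x_def y_def by (rule close[OF d(1)], assumption, rule close[OF d(2)])
    then show ?thesis using m(1) by blast
  qed
  have xy: "x \<in> \<Delta>" "y \<in> \<Delta>" by (simp_all add: x_def y_def order_combination)
  \<comment> \<open>The limits are congruent modulo \<open>layer 1\<close> to elements outside
    \<open>layer 1\<close>.\<close>
  have nz: "x \<noteq> 0" "y \<noteq> 0"
    using approx[of 1] xys by (auto simp: layer_closed(1))
  have "x * y \<in> layer (int n)" for n
  proof -
    obtain m where m: "m \<ge> n" "xs m - x \<in> layer (int n)" "ys m - y \<in> layer (int n)" using approx by blast
    have "xs m * ys m \<in> layer (int n)" using xys(3)[of m] layer_antimono[of "int n" "int m"] m(1) by auto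
    moreover have "(xs m - x) * ys m \<in> layer (int n + 0)" "x * (ys m - y) \<in> layer (0 + int n)"
      using m xys(2)[of m] xy by (intro layer_mult; simp)+
    ultimately have "xs m * ys m - (xs m - x) * ys m - x * (ys m - y) \<in> layer (int n)"
      using layer_closed(3) by simp
    then show ?thesis by (simp add: algebra_simps)
  qed
  then have "x * y = 0" by (rule layer_separated)
  then show False using nz by simp
qed

subsection \<open>The valuation\<close>

lemma layer_cut:
  assumes "x \<noteq> 0" shows "\<exists>k. \<forall>j. x \<in> layer j \<longleftrightarrow> j \<le> k"
proof -
  obtain n where "x \<in> layer (- int n)" using layer_exhaust by blast
  moreover obtain n' where "x \<notin> layer (int n')" using assms layer_separated by blast
  ultimately show ?thesis by (rule int_cut) (use layer_antimono in blast)
qed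

text \<open>At 0, which lies in every layer, no such \<open>k\<close> exists and the value is
  arbitrary; hence the separate case in \<open>layer_iff\<close>.\<close>

definition level :: "'d \<Rightarrow> int"
  where "level x = (SOME k. \<forall>j. x \<in> layer j \<longleftrightarrow> j \<le> k)"

lemma layer_iff: "x \<in> layer j \<longleftrightarrow> x = 0 \<or> j \<le> level x"
proof (cases "x = 0")
  case False
  from someI_ex[OF layer_cut[OF this]] show ?thesis unfolding level_def using False by blast
qed (simp add: layer_closed(1))

lemma level_eqI:
  assumes "x \<in> layer k" "x \<notin> layer (k + 1)" shows "level x = k"
  using assms by (auto simp: layer_iff)

lemma level_shift:
  assumes "x \<noteq> 0" shows "level (\<pi> powi j *s x) = level x + j"
  by (rule level_eqI) (use assms in \<open>simp_all add: layer_shift layer_iff[of x]\<close>)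

lemma level_mult_ge: "x \<noteq> 0 \<Longrightarrow> y \<noteq> 0 \<Longrightarrow> level x + level y \<le> level (x * y)"
  using layer_mult[of x "level x" y "level y"] by (auto simp: layer_iff)

lemma level_mult_le_ex:
  "\<exists>m::nat. \<forall>x y. x \<noteq> 0 \<longrightarrow> y \<noteq> 0 \<longrightarrow> level (x * y) \<le> level x + level y + int m"
proof -
  obtain m :: nat where m: "\<And>x y. x \<in> \<Delta> - layer 1 \<Longrightarrow> y \<in> \<Delta> - layer 1 \<Longrightarrow> x * y \<notin> layer (int m)"
    using order_mult_bound by blast
  have "level (x * y) \<le> level x + level y + int m" if nz: "x \<noteq> 0" "y \<noteq> 0" for x y
  proof -
    define x' y' where "x' = \<pi> powi (- level x) *s x" and "y' = \<pi> powi (- level y) *s y"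
    have nz': "x' \<noteq> 0" "y' \<noteq> 0" and lev: "level x' = 0" "level y' = 0"
      using nz by (simp_all add: x'_def y'_def level_shift)
    have "x' * y' = \<pi> powi (- level x - level y) *s (x * y)"
      using power_int_add[of \<pi> "- level x" "- level y"] by (simp add: x'_def y'_def mult.commute)
    moreover have "x' \<in> \<Delta> - layer 1" "y' \<in> \<Delta> - layer 1"
      using nz' lev layer_iff[of x' 0] layer_iff[of x' 1] layer_iff[of y' 0] layer_iff[of y' 1] by simp_all
    then have "x' * y' \<notin> layer (int m)" by (rule m)
    ultimately show ?thesis using nz nz' by (simp add: layer_iff level_shift)
  qed
  then show ?thesis by blast
qed

definition defect :: nat
  where "defect = (SOME m. \<forall>x y. x \<noteq> 0 \<longrightarrow> y \<noteq> 0 \<longrightarrow> level (x * y) \<le> level x + level y + int m)"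

lemma level_mult_le: "x \<noteq> 0 \<Longrightarrow> y \<noteq> 0 \<Longrightarrow> level (x * y) \<le> level x + level y + int defect"
  using someI_ex[OF level_mult_le_ex] unfolding defect_def by blast

lemma level_perturb:
  assumes "x \<noteq> 0" "e \<in> layer (level x + 1)" shows "level (x - e) = level x"
proof (rule level_eqI)
  have "e \<in> layer (level x)" using assms(2) layer_antimono[of "level x" "level x + 1"] by auto
  then show "x - e \<in> layer (level x)" by (intro layer_closed(3)) (simp add: layer_iff)
  show "x - e \<notin> layer (level x + 1)"
  proof
    assume "x - e \<in> layer (level x + 1)"
    then have "(x - e) + e \<in> layer (level x + 1)" using assms(2) by (rule layer_closed(2))
    then show False using assms(1) by (simp add: layer_iff)
  qed
qed

text \<open>\<open>level\<close> is multiplicative only up to a bounded error. Its averages over the finitely many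
  profiles \<open>z \<mapsto> level (z * x) - level x\<close> form a homomorphism, as right multiplication permutes
  the profiles (a transfer argument).\<close>

definition profile :: "'d \<Rightarrow> 'd \<Rightarrow> int"
  where "profile x z = (if z = 0 then 0 else level (z * x) - level x)"

definition profiles :: "('d \<Rightarrow> int) set"
  where "profiles = profile ` (- {0})"

lemma profile_bounds:
  assumes "x \<noteq> 0" "z \<noteq> 0"
  shows "level z \<le> profile x z" "profile x z \<le> level z + int defect"
  using level_mult_ge[of z x] level_mult_le[of z x] assms by (auto simp: profile_def)

lemma profile_shift: "x \<noteq> 0 \<Longrightarrow> profile (\<pi> powi j *s x) = profile x"
  by (rule ext) (simp add: profile_def level_shift)

text \<open>As \<open>level (z * x)\<close> is at most \<open>level z + int defect\<close>, the
  difference \<open>z * (x - x')\<close> lies one layer deeper than \<open>z * x\<close> and does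
  not affect its level.\<close>

lemma profile_cong:
  assumes "x \<noteq> 0" "x' \<noteq> 0" "level x = 0" "level x' = 0" "x - x' \<in> layer (int defect + 1)"
  shows "profile x = profile x'"
proof (rule ext)
  fix z
  show "profile x z = profile x' z"
  proof (cases "z = 0")
    case False
    have "z * (x - x') \<in> layer (level z + (int defect + 1))"
      using assms(5) by (intro layer_mult) (simp_all add: layer_iff)
    moreover have "level (z * x) + 1 \<le> level z + (int defect + 1)"
      using level_mult_le[OF False assms(1)] assms(3) by simp
    ultimately have "z * (x - x') \<in> layer (level (z * x) + 1)" using layer_antimono by blast
    then have "level (z * x - z * (x - x')) = level (z * x)"
      using False assms(1) by (intro level_perturb) auto
    then show ?thesis using assms(3,4) by (simp add: profile_def algebra_simps)
  qed (simp add: profile_def)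
qed

lemma finite_profiles: "finite profiles"
proof -
  from order_finite_residues[of "defect + 1"] obtain R
    where R: "finite R" "\<forall>x\<in>\<Delta>. \<exists>r\<in>R. x - r \<in> layer (int (defect + 1))" by blast
  define V where "V = {x. x \<noteq> 0 \<and> level x = 0}"
  \<comment> \<open>A residue \<open>r\<close> may itself have another level than 0, so it is
    replaced by an element of \<open>V\<close> in its class, to which \<open>profile_cong\<close>
    applies.\<close>
  define g where "g r = (SOME x. x \<in> V \<and> x - r \<in> layer (int (defect + 1)))" for r
  have "profiles \<subseteq> (\<lambda>r. profile (g r)) ` R"
  proof
    fix f assume "f \<in> profiles"
    then obtain x where x: "x \<noteq> 0" "f = profile x" by (auto simp: profiles_def)
    define x' where "x' = \<pi> powi (- level x) *s x"
    have x': "x' \<in> V" "f = profile x'" using x by (simp_all add: x'_def V_def level_shift profile_shift)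
    then have "x' \<in> layer 0" by (simp add: V_def layer_iff del: layer_0)
    then obtain r where r: "r \<in> R" "x' - r \<in> layer (int (defect + 1))" using R(2) by auto
    then have g: "g r \<in> V \<and> g r - r \<in> layer (int (defect + 1))"
      unfolding g_def using x'(1) by (intro someI_ex[of "\<lambda>x. x \<in> V \<and> x - r \<in> layer (int (defect + 1))"]) blast
    then have "(x' - r) - (g r - r) \<in> layer (int (defect + 1))" by (rule layer_closed(3)[OF r(2) conjunct2])
    then have "profile x' = profile (g r)"
      using x'(1) g by (intro profile_cong) (simp_all add: V_def add.commute)
    then show "f \<in> (\<lambda>r. profile (g r)) ` R" using x'(2) r(1) by blast
  qed
  then show ?thesis using R(1) by (meson finite_surj)
qed

text \<open>The sum is left undivided so that values stay integers. It differs from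
  \<open>num_profiles * level y\<close> by a bounded amount, but is exactly additive on
  products.\<close>

definition weight :: "'d \<Rightarrow> int"
  where "weight y = (\<Sum>f\<in>profiles. f y)"

abbreviation num_profiles :: int where "num_profiles \<equiv> int (card profiles)"

lemma num_profiles_pos: "num_profiles > 0"
proof -
  have "profile 1 \<in> profiles" by (simp add: profiles_def)
  then have "profiles \<noteq> {}" by blast
  then show ?thesis using finite_profiles by (simp add: card_gt_0_iff)
qed

lemma weight_bounds:
  assumes "y \<noteq> 0"
  shows "num_profiles * level y \<le> weight y" "weight y \<le> num_profiles * (level y + int defect)"
proof -
  have "level y \<le> f y" "f y \<le> level y + int defect" if "f \<in> profiles" for f
    using that profile_bounds assms by (auto simp: profiles_def)
  then show "num_profiles * level y \<le> weight y" "weight y \<le> num_profiles * (level y + int defect)"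
    unfolding weight_def by (simp_all add: sum_bounded_below sum_bounded_above)
qed

lemma weight_mult:
  assumes "y \<noteq> 0" "z \<noteq> 0"
  shows "weight (y * z) = weight y + weight z"
proof -
  \<comment> \<open>The action of \<open>z\<close> on profiles sends \<open>profile x\<close> to
    \<open>profile (z * x)\<close>. It is a permutation because \<open>z\<close> is invertible, so
    summing \<open>f (y * z) = T f y + f z\<close> over all profiles gives additivity.\<close>
  define T where "T f = (\<lambda>u. if u = 0 then 0 else f (u * z) - f z)" for f :: "'d \<Rightarrow> int"
  have T: "T (profile x) = profile (z * x)" if "x \<noteq> 0" for x
    using that assms(2) by (auto simp: T_def profile_def fun_eq_iff mult.assoc)
  have "T ` profiles = profiles"
  proof (intro equalityI subsetI)
    fix f assume "f \<in> T ` profiles"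
    then obtain x where "x \<noteq> 0" "f = T (profile x)" by (auto simp: profiles_def)
    then show "f \<in> profiles" using T assms(2) by (auto simp: profiles_def)
  next
    fix f assume "f \<in> profiles"
    then obtain x where x: "x \<noteq> 0" "f = profile x" by (auto simp: profiles_def)
    define x' where "x' = inverse z * x"
    have "x' \<noteq> 0" "f = T (profile x')" using x assms(2) by (simp_all add: x'_def T flip: mult.assoc)
    then show "f \<in> T ` profiles" by (auto simp: profiles_def)
  qed
  then have bij: "bij_betw T profiles profiles"
    using finite_profiles by (simp add: bij_betw_def eq_card_imp_inj_on)
  have "f (y * z) = T f y + f z" if "f \<in> profiles" for f
    using assms(1) by (simp add: T_def)
  then have "weight (y * z) = (\<Sum>f\<in>profiles. T f y) + weight z"
    unfolding weight_def sum.distrib[symmetric] by (rule sum.cong[OF refl])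
  also have "(\<Sum>f\<in>profiles. T f y) = weight y"
    unfolding weight_def by (rule sum.reindex_bij_betw[OF bij])
  finally show ?thesis .
qed

lemma weight_1: "weight 1 = 0"
  using weight_mult[of 1 1] by simp

lemma weight_power: "x \<noteq> 0 \<Longrightarrow> weight (x ^ n) = int n * weight x"
  by (induction n) (simp_all add: weight_1 weight_mult algebra_simps)

subsection \<open>The ring of integral elements\<close>

text \<open>These are the power-bounded elements: one direction is \<open>integral_power\<close>
  with \<open>integral_subset_layer\<close>, the other \<open>power_bounded_imp_integral\<close>.
  Closure under products is read off from the weight, closure under sums and Jordan maps from
  power-boundedness.\<close>

definition integral :: "'d set"
  where "integral = {x. x = 0 \<or> 0 \<le> weight x}"

lemma integral_subset_layer: "integral \<subseteq> layer (- int defect)"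
proof
  fix x assume x: "x \<in> integral"
  show "x \<in> layer (- int defect)"
  proof (cases "x = 0")
    case False
    then have "0 \<le> num_profiles * (level x + int defect)"
      using x weight_bounds(2)[OF False] by (auto simp: integral_def)
    then show ?thesis using num_profiles_pos by (simp add: layer_iff zero_le_mult_iff)
  qed (simp add: layer_closed(1))
qed

lemma order_subset_integral: "\<Delta> \<subseteq> integral"
proof
  fix x assume x: "x \<in> \<Delta>"
  show "x \<in> integral"
  proof (cases "x = 0")
    case False
    then have "0 \<le> level x" using x layer_iff[of x 0] by simp
    then have "0 \<le> num_profiles * level x" by simp
    then show ?thesis using weight_bounds(1)[OF False] by (simp add: integral_def)
  qed (simp add: integral_def)
qed

lemma integral_mult: "x \<in> integral \<Longrightarrow> y \<in> integral \<Longrightarrow> x * y \<in> integral"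
  by (cases "x = 0 \<or> y = 0") (auto simp: integral_def weight_mult)

lemma integral_power: "x \<in> integral \<Longrightarrow> x ^ n \<in> integral"
  by (cases "x = 0") (auto simp: integral_def weight_power zero_power power_0_left weight_1)

lemma power_bounded_imp_integral:
  assumes "\<And>n. x ^ n \<in> layer (- int c)"
  shows "x \<in> integral"
proof (rule ccontr)
  assume "x \<notin> integral"
  then have x: "x \<noteq> 0" "weight x \<le> -1" by (auto simp: integral_def)
  \<comment> \<open>Chosen so that \<open>int n\<close> exceeds \<open>num_profiles * int c\<close>,
    the amount by which the weight of an element of \<open>layer (- int c)\<close> can be
    negative.\<close>
  define n where "n = Suc (nat num_profiles * c)"
  have "x ^ n \<noteq> 0" using x(1) by simp
  then have "- int c \<le> level (x ^ n)" using assms[of n] layer_iff by blast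
  then have "num_profiles * (- int c) \<le> num_profiles * level (x ^ n)" by (intro mult_left_mono) simp_all
  also have "\<dots> \<le> weight (x ^ n)" using \<open>x ^ n \<noteq> 0\<close> by (rule weight_bounds(1))
  also have "\<dots> = int n * weight x" using x(1) by (rule weight_power)
  also have "\<dots> \<le> int n * (-1)" using x(2) by (intro mult_left_mono) simp_all
  finally show False by (simp add: n_def)
qed

text \<open>Powers of \<open>1 + u\<close> are sums of powers of \<open>u\<close>, which all lie in
  the one subgroup \<open>layer (- int defect)\<close>; so they are bounded. The extra factor
  \<open>u ^ i\<close> lets the induction run without binomial coefficients.\<close>

lemma integral_1_add:
  assumes "u \<in> integral"
  shows "1 + u \<in> integral"
proof (rule power_bounded_imp_integral)
  have "(1 + u) ^ n * u ^ i \<in> layer (- int defect)" for n i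
  proof (induction n arbitrary: i)
    case 0
    then show ?case using integral_power[OF assms] integral_subset_layer by auto
  next
    case (Suc n)
    have "(1 + u) ^ Suc n * u ^ i = (1 + u) ^ n * ((1 + u) * u ^ i)"
      by (simp only: power_Suc2 mult.assoc)
    also have "\<dots> = (1 + u) ^ n * u ^ i + (1 + u) ^ n * u ^ Suc i"
      by (simp add: distrib_left distrib_right)
    finally show ?case using layer_closed(2)[OF Suc.IH Suc.IH] by (simp only:)
  qed
  from this[of _ 0] show "(1 + u) ^ n \<in> layer (- int defect)" for n by simp
qed

text \<open>Factoring out the summand of smaller weight on the right reduces the sum to
  \<open>integral_1_add\<close>.\<close>

lemma integral_add:
  assumes "x \<in> integral" "y \<in> integral"
  shows "x + y \<in> integral"
proof -
  have *: "x + y \<in> integral"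
    if "x \<in> integral" "y \<in> integral" "x \<noteq> 0" "y \<noteq> 0" "weight y \<le> weight x" for x y
  proof -
    have "weight (x * inverse y) + weight y = weight x"
      using that by (subst weight_mult[symmetric]) (simp_all add: mult.assoc)
    then have "x * inverse y \<in> integral" using that(5) by (simp add: integral_def)
    then have "(1 + x * inverse y) * y \<in> integral" by (intro integral_mult[OF integral_1_add that(2)])
    then show ?thesis using that(4) by (simp add: distrib_right mult.assoc add.commute)
  qed
  show ?thesis
  proof (cases "x = 0 \<or> y = 0")
    case False
    then show ?thesis
      using assms *[of x y] *[of y x] by (cases "weight y \<le> weight x") (auto simp: add.commute)
  qed (use assms in auto)
qed

lemma integral_scale: "x \<in> integral \<Longrightarrow> padic_of_int a *s x \<in> integral"
  using integral_mult[of "padic_of_int a *s 1" x] order_subset_integral order_scale[OF one_in_order, of a] by auto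

lemma integral_diff: "x \<in> integral \<Longrightarrow> y \<in> integral \<Longrightarrow> x - y \<in> integral"
  using integral_add[of x "padic_of_int (-1) *s y"] integral_scale[of y "-1"]
  by (simp flip: One_fract_def minus_fract)

text \<open>A linear map sends the finitely generated \<open>\<Delta>\<close> into some layer, and
  all powers of \<open>x\<close> lie in one multiple of \<open>\<Delta>\<close>. Hence the powers of
  \<open>\<psi> x\<close> are bounded.\<close>

lemma integral_jordan:
  assumes \<psi>: "\<And>x y. \<psi> (x + y) = \<psi> x + \<psi> y" "\<And>a x. \<psi> (a *s x) = a *s \<psi> x"
    "\<And>x n. \<psi> (x ^ n) = \<psi> x ^ n"
    and x: "x \<in> integral"
  shows "\<psi> x \<in> integral"
proof -
  obtain c where c: "\<psi> ` gens \<subseteq> layer (- int c)" using layer_exhaust_finite gens(1) by blast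
  have 0: "\<psi> 0 = 0" using \<psi>(2)[of 0 0] by simp
  have sum: "\<psi> (\<Sum>b\<in>A. h b) = (\<Sum>b\<in>A. \<psi> (h b))" for A and h :: "'d \<Rightarrow> 'd"
    by (induction A rule: infinite_finite_induct) (simp_all add: 0 \<psi>(1))
  have \<Delta>: "\<psi> y \<in> layer (- int c)" if "y \<in> \<Delta>" for y
  proof -
    from order_coordinates[OF that] obtain u where "y = (\<Sum>b\<in>gens. padic_of_int (u b) *s b)" by blast
    then show ?thesis using c by (auto simp: sum \<psi>(2) intro!: layer_closed(5) layer_scale)
  qed
  have "\<psi> x ^ n \<in> layer (- int (c + defect))" for n
  proof -
    have "x ^ n \<in> layer (- int defect)" using integral_power[OF x] integral_subset_layer by blast
    then have "\<pi> ^ defect *s x ^ n \<in> \<Delta>" by (simp add: layer_def)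
    then have "\<pi> ^ defect *s \<psi> x ^ n \<in> layer (- int c)" using \<Delta> by (metis \<psi>(2,3))
    then show ?thesis by (simp add: layer_shift_nat)
  qed
  then show ?thesis by (rule power_bounded_imp_integral)
qed

end

section \<open>Virtual endomorphisms of traceless lattices\<close>

text \<open>The finite indices enter through the exponent \<open>N\<close> alone: \<open>M\<close>
  contains every traceless element of \<open>layer (int N)\<close>.\<close>

locale traceless_virtual_endomorphism = padic_order scale Basis \<Delta>
  for scale :: "'p :: prime_card padic \<Rightarrow> 'd :: division_ring \<Rightarrow> 'd" (infixr \<open>*s\<close> 75)
    and Basis and \<Delta> +
  fixes L M :: "'d set" and \<phi> :: "'d \<Rightarrow> 'd" and N :: nat
  assumes L_order: "L \<subseteq> \<Delta>"
    and L_traceless: "x \<in> L \<Longrightarrow> ntrace x = 0"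
    and M_subset: "M \<subseteq> L"
    and M_subspace: "Z.subspace M"
    and M_commutator: "x \<in> M \<Longrightarrow> y \<in> M \<Longrightarrow> commutator x y \<in> M"
    and M_open: "x \<in> \<Delta> \<Longrightarrow> ntrace x = 0 \<Longrightarrow> \<pi> ^ N *s x \<in> M"
    and \<phi>_L: "x \<in> M \<Longrightarrow> \<phi> x \<in> L"
    and \<phi>_add: "x \<in> M \<Longrightarrow> y \<in> M \<Longrightarrow> \<phi> (x + y) = \<phi> x + \<phi> y"
    and \<phi>_scale: "x \<in> M \<Longrightarrow> \<phi> (padic_of_int a *s x) = padic_of_int a *s \<phi> x"
    and \<phi>_commutator: "x \<in> M \<Longrightarrow> y \<in> M \<Longrightarrow> \<phi> (commutator x y) = commutator (\<phi> x) (\<phi> y)"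
begin

lemma M_scale: "x \<in> M \<Longrightarrow> padic_of_int a *s x \<in> M"
  using Z.subspace_scale[OF M_subspace, of x a] by (simp add: zp_scale_def)

lemma M_power: "x \<in> M \<Longrightarrow> \<pi> ^ n *s x \<in> M" and \<phi>_power: "x \<in> M \<Longrightarrow> \<phi> (\<pi> ^ n *s x) = \<pi> ^ n *s \<phi> x"
  using M_scale[of x "of_nat CARD('p) ^ n"] \<phi>_scale[of x "of_nat CARD('p) ^ n"]
  by (simp_all only: padic_of_int_power)

lemma layer_M: "x \<in> layer (int N) \<Longrightarrow> ntrace x = 0 \<Longrightarrow> x \<in> M"
  using M_open[of "inverse (\<pi> ^ N) *s x"] by (simp add: layer_def power_int_minus)

section \<open>Extension of \<open>\<phi>\<close> to the traceless elements of
  \<open>D\<close>\<close>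

lemma multiple_in_M:
  assumes "ntrace x = 0" shows "\<exists>c. \<pi> ^ c *s x \<in> M"
proof -
  obtain n where "x \<in> layer (- int n)" using layer_exhaust by blast
  then have "\<pi> ^ (n + N) *s x \<in> layer (int N)" by (simp add: layer_shift_nat)
  then show ?thesis using assms layer_M[of "\<pi> ^ (n + N) *s x"] by auto
qed

text \<open>By \<open>ext_eq\<close> the exponent chosen does not matter when \<open>x\<close> is
  traceless. An element of nonzero trace has no multiple in \<open>M\<close>, and there the value is
  arbitrary.\<close>

definition ext :: "'d \<Rightarrow> 'd"
  where "ext x = (let c = SOME c. \<pi> ^ c *s x \<in> M in inverse (\<pi> ^ c) *s \<phi> (\<pi> ^ c *s x))"

lemma ext_eq:
  assumes "\<pi> ^ c *s x \<in> M" shows "\<pi> ^ c *s ext x = \<phi> (\<pi> ^ c *s x)"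
proof -
  define d where "d = (SOME c. \<pi> ^ c *s x \<in> M)"
  have d: "\<pi> ^ d *s x \<in> M" unfolding d_def using assms by (rule someI)
  have "\<pi> ^ c *s \<phi> (\<pi> ^ d *s x) = \<phi> (\<pi> ^ c *s \<pi> ^ d *s x)" using d by (simp only: \<phi>_power)
  also have "\<pi> ^ c *s \<pi> ^ d *s x = \<pi> ^ d *s \<pi> ^ c *s x" by (simp add: mult.commute)
  also have "\<phi> (\<pi> ^ d *s \<pi> ^ c *s x) = \<pi> ^ d *s \<phi> (\<pi> ^ c *s x)" using assms by (rule \<phi>_power)
  finally have *: "\<pi> ^ c *s \<phi> (\<pi> ^ d *s x) = \<pi> ^ d *s \<phi> (\<pi> ^ c *s x)" .
  have "ext x = inverse (\<pi> ^ d) *s \<phi> (\<pi> ^ d *s x)" by (simp add: ext_def d_def Let_def)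
  then have "\<pi> ^ c *s ext x = inverse (\<pi> ^ d) *s \<pi> ^ c *s \<phi> (\<pi> ^ d *s x)" by (simp add: mult.commute)
  also have "\<dots> = \<phi> (\<pi> ^ c *s x)" unfolding * by simp
  finally show ?thesis .
qed

lemma ext_eqI:
  assumes "\<pi> ^ c *s x \<in> M" "\<phi> (\<pi> ^ c *s x) = \<pi> ^ c *s y" shows "ext x = y"
  using ext_eq[OF assms(1)] assms(2) by simp

lemma ext_M: "x \<in> M \<Longrightarrow> ext x = \<phi> x"
  by (rule ext_eqI[of 0]) simp_all

lemma ext_traceless: "ntrace x = 0 \<Longrightarrow> ntrace (ext x) = 0"
proof -
  assume "ntrace x = 0"
  then obtain c where c: "\<pi> ^ c *s x \<in> M" using multiple_in_M by blast
  have "ntrace (\<pi> ^ c *s ext x) = 0" using L_traceless[OF \<phi>_L[OF c]] by (simp only: ext_eq[OF c])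
  then show ?thesis by simp
qed

lemma ext_add:
  assumes "ntrace x = 0" "ntrace y = 0" shows "ext (x + y) = ext x + ext y"
proof -
  obtain c d where c: "\<pi> ^ c *s x \<in> M" "\<pi> ^ d *s y \<in> M" using multiple_in_M assms by blast
  have cd: "\<pi> ^ (c + d) *s x \<in> M" "\<pi> ^ (c + d) *s y \<in> M"
    using M_power[OF c(1), of d] M_power[OF c(2), of c] by (simp_all add: power_add mult.commute)
  show ?thesis
  proof (rule ext_eqI)
    show "\<pi> ^ (c + d) *s (x + y) \<in> M"
      using Z.subspace_add[OF M_subspace cd] by (simp only: scale_right_distrib)
    show "\<phi> (\<pi> ^ (c + d) *s (x + y)) = \<pi> ^ (c + d) *s (ext x + ext y)"
      by (simp only: scale_right_distrib \<phi>_add[OF cd] ext_eq[OF cd(1)] ext_eq[OF cd(2)])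
  qed
qed

lemma ext_scale:
  assumes "ntrace x = 0" shows "ext (a *s x) = a *s ext x"
proof -
  obtain c where c: "\<pi> ^ c *s x \<in> M" using multiple_in_M assms by blast
  obtain m b where b: "\<pi> ^ m * a = padic_of_int b" using padic_integral_multiple by blast
  have *: "\<pi> ^ (m + c) *s a *s y = padic_of_int b *s \<pi> ^ c *s y" for y
    by (simp add: power_add mult_ac flip: b)
  show ?thesis
    by (rule ext_eqI[of "m + c"]) (simp_all only: * M_scale[OF c] \<phi>_scale[OF c] ext_eq[OF c])
qed

lemma ext_commutator:
  assumes "ntrace x = 0" "ntrace y = 0" shows "ext (commutator x y) = commutator (ext x) (ext y)"
proof -
  obtain c d where c: "\<pi> ^ c *s x \<in> M" "\<pi> ^ d *s y \<in> M" using multiple_in_M assms by blast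
  have *: "\<pi> ^ (c + d) *s commutator u v = commutator (\<pi> ^ c *s u) (\<pi> ^ d *s v)" for u v
    by (simp add: power_add)
  show ?thesis
    by (rule ext_eqI[of "c + d"])
      (simp_all only: * M_commutator[OF c] \<phi>_commutator[OF c] ext_eq[OF c(1)] ext_eq[OF c(2)])
qed

section \<open>Invariant ideals as traceless parts of submodules deep inside
  \<open>D\<close>\<close>

lemma ideal_traceless_layer:
  assumes R: "Z.subspace R" "R \<subseteq> layer (int N)"
    and R_commutator: "\<And>x y. x \<in> L \<Longrightarrow> y \<in> R \<Longrightarrow> ntrace y = 0 \<Longrightarrow> commutator x y \<in> R"
    and R_ext: "\<And>x. x \<in> R \<Longrightarrow> ntrace x = 0 \<Longrightarrow> ext x \<in> R"
  shows "invariant_ideal (zp_scale scale) commutator L M \<phi> {x \<in> R. ntrace x = 0}" (is "invariant_ideal _ _ _ _ _ ?I")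
proof -
  have I_M: "?I \<subseteq> M" using R(2) layer_M by blast
  have "Z.subspace ?I"
  proof (rule Z.subspaceI)
    show "0 \<in> ?I" using Z.subspace_0[OF R(1)] by simp
    show "x + y \<in> ?I" if "x \<in> ?I" "y \<in> ?I" for x y
      using that Z.subspace_add[OF R(1)] by simp
    show "zp_scale scale c x \<in> ?I" if "x \<in> ?I" for c x
      using that Z.subspace_scale[OF R(1), of x c] by (simp add: zp_scale_def)
  qed
  moreover have "commutator x y \<in> ?I" if "x \<in> L" "y \<in> ?I" for x y
    using that R_commutator by simp
  moreover have "\<phi> x \<in> ?I" if "x \<in> ?I" for x
  proof -
    have "x \<in> M" using that I_M by blast
    then have "\<phi> x = ext x" by (simp add: ext_M)
    then show ?thesis using that R_ext ext_traceless by simp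
  qed
  ultimately show ?thesis
    unfolding invariant_ideal_def lie_ideal_def using I_M M_subset by blast
qed

text \<open>On the kernel of \<open>ext\<close> invariance is automatic. Brackets with
  \<open>L\<close> preserve the layer because \<open>L\<close> lies in \<open>\<Delta>\<close>, and
  a multiple of \<open>x0\<close> lies deep enough.\<close>

lemma invariant_ideal_kernel:
  assumes x0: "x0 \<noteq> 0" "ntrace x0 = 0" "ext x0 = 0"
  shows "\<exists>I. I \<noteq> {0} \<and> invariant_ideal (zp_scale scale) commutator L M \<phi> I"
proof -
  define R where "R = {x \<in> layer (int N). ntrace x = 0 \<and> ext x = 0}"
  have ext_0: "ext 0 = 0" using ext_scale[of 0 0] by simp
  have sub: "Z.subspace R"
  proof (rule Z.subspaceI)
    show "0 \<in> R" by (simp add: R_def ext_0 layer_closed(1))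
    show "x + y \<in> R" if "x \<in> R" "y \<in> R" for x y
      using that layer_closed(2) by (simp add: R_def ext_add)
    show "zp_scale scale c x \<in> R" if "x \<in> R" for c x
      using that layer_scale by (simp add: R_def zp_scale_def ext_scale)
  qed
  have "invariant_ideal (zp_scale scale) commutator L M \<phi> {x \<in> R. ntrace x = 0}"
  proof (rule ideal_traceless_layer)
    show "Z.subspace R" by fact
    show "R \<subseteq> layer (int N)" by (auto simp: R_def)
    show "ext x \<in> R" if "x \<in> R" for x using that by (simp add: R_def ext_0 layer_closed(1))
    fix x y assume xy: "x \<in> L" "y \<in> R"
    have "x \<in> layer 0" using xy(1) L_order by auto
    then have "x * y \<in> layer (int N)" "y * x \<in> layer (int N)"
      using xy(2) layer_mult[of x 0 y "int N"] layer_mult[of y "int N" x 0] by (auto simp: R_def)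
    then have "commutator x y \<in> layer (int N)" unfolding commutator_def by (rule layer_closed(3))
    then show "commutator x y \<in> R"
      using xy by (simp add: R_def ext_commutator L_traceless commutator_simps)
  qed
  moreover obtain n where "x0 \<in> layer (- int n)" using layer_exhaust by blast
  then have "\<pi> ^ (n + N) *s x0 \<in> layer (int N)" by (simp add: layer_shift_nat)
  then have "\<pi> ^ (n + N) *s x0 \<in> {x \<in> R. ntrace x = 0}" using x0 by (simp add: R_def ext_scale)
  moreover have "\<pi> ^ (n + N) *s x0 \<noteq> 0" using x0(1) by simp
  ultimately show ?thesis by (metis singletonD)
qed

lemma invariant_ideal_automorphism:
  assumes inj: "\<And>x. ntrace x = 0 \<Longrightarrow> ext x = 0 \<Longrightarrow> x = 0"
    and noncomm: "\<exists>x y :: 'd. x * y \<noteq> y * x"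
  shows "\<exists>I. I \<noteq> {0} \<and> invariant_ideal (zp_scale scale) commutator L M \<phi> I"
proof -
  define pr where "pr x = x - ntrace x *s 1" for x
  have pr [simp]: "ntrace (pr x) = 0" for x by (simp add: pr_def)
  have pr_simps: "pr (x + y) = pr x + pr y" "pr (a *s x) = a *s pr x" "pr 1 = 0" for x y a
    by (simp_all add: pr_def scale_left_distrib scale_right_diff_distrib)
  define \<theta> where "\<theta> x = ntrace x *s 1 + ext (pr x)" for x
  have \<theta>: "\<theta> (x + y) = \<theta> x + \<theta> y" "\<theta> (a *s x) = a *s \<theta> x" for x y a
    by (simp_all add: \<theta>_def pr_simps ext_add ext_scale scale_left_distrib scale_right_distrib)
  have \<theta>_0: "\<theta> 0 = 0" using \<theta>(2)[of 0 0] by simp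
  have \<theta>_diff: "\<theta> (x - y) = \<theta> x - \<theta> y" for x y using \<theta>(1)[of "x - y" y] by simp
  have ext: "ext x = \<theta> x" if "ntrace x = 0" for x using that by (simp add: \<theta>_def pr_def)
  have "x = 0" if "\<theta> x = 0" for x
  proof -
    have "ntrace (\<theta> x) = ntrace x" by (simp add: \<theta>_def ext_traceless)
    then have "ntrace x = 0" using that by simp
    then show ?thesis using that ext inj by simp
  qed
  then have "inj \<theta>" using \<theta>_diff by (metis injI eq_iff_diff_eq_0)
  moreover have "Vector_Spaces.linear scale scale \<theta>"
    unfolding Vector_Spaces.linear_iff by (simp add: vector_space_axioms \<theta>)
  ultimately have "surj \<theta>" by (intro linear_inj_imp_surj)
  interpret lie_automorphism scale Basis \<theta>
  proof
    show "bij \<theta>" using \<open>inj \<theta>\<close> \<open>surj \<theta>\<close> by (simp add: bij_def)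
    show "\<theta> 1 = 1" using ext_scale[of 0 0] by (simp add: \<theta>_def pr_simps)
    fix x y
    have "\<theta> (commutator x y) = ext (commutator (pr x) (pr y))" by (simp add: \<theta>_def pr_def)
    also have "\<dots> = commutator (ext (pr x)) (ext (pr y))" by (simp add: ext_commutator)
    also have "\<dots> = commutator (\<theta> x) (\<theta> y)" by (simp add: \<theta>_def commutator_simps)
    finally show "\<theta> (commutator x y) = commutator (\<theta> x) (\<theta> y)" .
  qed (simp_all add: \<theta>)
  obtain \<epsilon> where \<epsilon>: "\<epsilon> * \<epsilon> = 1"
    "\<And>x m. \<epsilon> *s \<theta> (x ^ m) + ((1 - \<epsilon>) * ntrace (x ^ m)) *s 1 = (\<epsilon> *s \<theta> x + ((1 - \<epsilon>) * ntrace x) *s 1) ^ m"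
    using jordan_twist unfolding Let_def by blast
  define \<psi> where "\<psi> x = \<epsilon> *s \<theta> x + ((1 - \<epsilon>) * ntrace x) *s 1" for x
  have \<psi>: "\<psi> x \<in> integral" if "x \<in> integral" for x
  proof (rule integral_jordan[of \<psi>])
    show "\<psi> (x + y) = \<psi> x + \<psi> y" for x y
      by (simp add: \<psi>_def scale_right_distrib distrib_left scale_left_distrib algebra_simps)
    show "\<psi> (a *s x) = a *s \<psi> x" for a x
      by (simp add: \<psi>_def scale_right_distrib mult_ac)
    show "\<psi> (x ^ n) = \<psi> x ^ n" for x n unfolding \<psi>_def by (rule \<epsilon>(2))
  qed fact
  \<comment> \<open>On traceless elements \<open>\<theta>\<close> and the Jordan map
    \<open>\<psi>\<close> differ only by the sign \<open>\<epsilon>\<close>.\<close>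
  have int: "\<theta> x \<in> integral" if x: "x \<in> integral" "ntrace x = 0" for x
  proof -
    have "\<epsilon> = 1 \<or> \<epsilon> = -1" using \<epsilon>(1) by (simp add: square_eq_1_iff)
    moreover have "\<psi> x = \<epsilon> *s \<theta> x" by (simp add: \<psi>_def x(2))
    ultimately have "\<theta> x = \<psi> x \<or> \<theta> x = 0 - \<psi> x" by auto
    moreover have "0 \<in> integral" by (simp add: integral_def)
    ultimately show ?thesis using \<psi>[OF x(1)] integral_diff by metis
  qed
  \<comment> \<open>The factor \<open>\<pi> ^ defect\<close> carries \<open>integral\<close> into
    \<open>\<Delta>\<close>, and \<open>\<pi> ^ N\<close> carries the result into the layer whose
    traceless elements lie in \<open>M\<close>.\<close>
  define q where "q = \<pi> ^ (N + defect)"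
  have q: "q \<noteq> 0" by (simp add: q_def)
  define R where "R = {x. inverse q *s x \<in> integral}"
  have "invariant_ideal (zp_scale scale) commutator L M \<phi> {x \<in> R. ntrace x = 0}"
  proof (rule ideal_traceless_layer)
    show "Z.subspace R"
    proof (rule Z.subspaceI)
      show "0 \<in> R" by (simp add: R_def integral_def)
      show "x + y \<in> R" if "x \<in> R" "y \<in> R" for x y
        using that integral_add by (simp add: R_def scale_right_distrib)
      show "zp_scale scale c x \<in> R" if "x \<in> R" for c x
        using that integral_scale[of "inverse q *s x" c] by (simp add: R_def zp_scale_def mult.commute)
    qed
    show "R \<subseteq> layer (int N)"
    proof
      fix x assume "x \<in> R"
      then have "inverse q *s x \<in> layer (- int defect)" using integral_subset_layer by (auto simp: R_def)
      then have "q *s inverse q *s x \<in> layer (int N)" by (simp only: q_def layer_shift_nat) simp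
      then show "x \<in> layer (int N)" using q by simp
    qed
    show "ext x \<in> R" if "x \<in> R" "ntrace x = 0" for x
      using that int[of "inverse q *s x"] by (simp add: R_def ext)
    fix x y assume xy: "x \<in> L" "y \<in> R"
    have x: "x \<in> integral" using xy(1) L_order order_subset_integral by blast
    have "x * (inverse q *s y) - (inverse q *s y) * x \<in> integral"
      using x xy(2) by (intro integral_diff integral_mult) (simp_all add: R_def)
    then show "commutator x y \<in> R" by (simp add: R_def commutator_def scale_right_diff_distrib)
  qed
  note ideal = this
  \<comment> \<open>Noncommutativity makes the ideal nonzero: commutators are traceless, and a
    suitable multiple of a nonzero one lies in \<open>\<Delta>\<close>.\<close>
  obtain x y :: 'd where "commutator x y \<noteq> 0"
    using noncomm by (auto simp: commutator_eq_0_iff)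
  obtain n where "commutator x y \<in> layer (- int n)" using layer_exhaust by blast
  then have "\<pi> ^ n *s commutator x y \<in> \<Delta>" by (simp add: layer_def)
  define v where "v = \<pi> ^ n *s commutator x y"
  have "v \<in> integral" using \<open>\<pi> ^ n *s commutator x y \<in> \<Delta>\<close> order_subset_integral by (auto simp: v_def)
  moreover have "ntrace v = 0" by (simp add: v_def)
  ultimately have "q *s v \<in> {x \<in> R. ntrace x = 0}" using q by (simp add: R_def)
  moreover have "q *s v \<noteq> 0" using q \<open>commutator x y \<noteq> 0\<close> by (simp add: v_def)
  ultimately show ?thesis using ideal by (metis singletonD)
qed

theorem not_simple:
  assumes "\<exists>x y :: 'd. x * y \<noteq> y * x"
  shows "\<not> simple_endomorphism (zp_scale scale) commutator L M \<phi>"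
  unfolding simple_endomorphism_def
  using invariant_ideal_kernel invariant_ideal_automorphism assms by blast

end

section \<open>The reduced trace\<close>

context central_division_algebra
begin

text \<open>The matrix trace after \<open>\<rho>\<close> is linear over the base field and kills
  commutators, so it equals \<open>n\<close> times \<open>ntrace\<close>, with \<open>n\<close>
  nonzero in characteristic 0.\<close>

lemma reduced_trace_eq_0_iff:
  assumes "splitting scale n \<rho>"
  shows "(\<Sum>i<n. \<rho> x $$ (i, i)) = 0 \<longleftrightarrow> ntrace x = 0"
proof -
  have carrier: "\<rho> x \<in> carrier_mat n n" for x using assms by (simp add: splitting_def)
  have dim: "dim_row (\<rho> x) = n" "dim_col (\<rho> x) = n" for x using carrier[of x] by auto
  define T where "T x = (\<Sum>i<n. \<rho> x $$ (i, i))" for x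
  have T_add: "T (x + y) = T x + T y" for x y
    using assms by (simp add: T_def splitting_def dim sum.distrib)
  have T_scale: "T (a *s x) = to_ac a * T x" for a x
    using assms by (simp add: T_def splitting_def dim sum_distrib_left)
  have T_1: "T 1 = of_nat n" using assms by (simp add: T_def splitting_def)
  have T_mult: "T (x * y) = (\<Sum>i<n. \<Sum>j<n. \<rho> x $$ (i, j) * \<rho> y $$ (j, i))" for x y
    using assms by (simp add: T_def splitting_def dim scalar_prod_def atLeast0LessThan)
  have "T (x * y) = T (y * x)" for x y
    unfolding T_mult by (subst sum.swap) (simp add: mult.commute)
  then have T_commutator: "T (commutator x y) = 0" for x y
    using T_add[of "commutator x y" "y * x"] by (simp add: commutator_def)
  \<comment> \<open>For \<open>n = 0\<close> the matrix equations are empty, so the uniqueness of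
    \<open>c\<close> in \<open>splitting\<close> fails on a nonempty basis of
    \<open>D\<close>.\<close>
  have n: "n > 0"
  proof (rule ccontr)
    assume "\<not> n > 0"
    then have n: "n = 0" by simp
    have "\<exists>B. finite_dimensional_vector_space scale B \<and>
      (\<forall>A \<in> carrier_mat n n. \<exists>!c. (\<forall>b. b \<notin> B \<longrightarrow> c b = 0) \<and>
        (\<forall>i<n. \<forall>j<n. A $$ (i, j) = (\<Sum>b\<in>B. c b * \<rho> b $$ (i, j))))"
      (is "\<exists>B. ?P B")
      using assms by (simp only: splitting_def)
    then obtain B where *: "?P B" ..
    note B = conjunct1[OF *] conjunct2[OF *]
    have "B \<noteq> {}"
    proof
      assume "B = {}"
      moreover have "span B = UNIV" using B(1) by (rule finite_dimensional_vector_space.span_Basis)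
      ultimately have "(1 :: 'd) \<in> span {}" by simp
      then show False by simp
    qed
    then obtain b where b: "b \<in> B" by blast
    have "\<exists>!c :: 'd \<Rightarrow> 'k alg_closure. \<forall>b. b \<notin> B \<longrightarrow> c b = 0"
      using bspec[OF B(2), of "0\<^sub>m n n"] n by simp
    then obtain c0 :: "'d \<Rightarrow> 'k alg_closure"
      where *: "(\<forall>b. b \<notin> B \<longrightarrow> c0 b = 0) \<and> (\<forall>c. (\<forall>b. b \<notin> B \<longrightarrow> c b = 0) \<longrightarrow> c = c0)"
      unfolding Ex1_def ..
    note c0 = conjunct2[OF *, rule_format]
    have 1: "(\<lambda>_. 0) = c0" by (rule c0) simp
    have 2: "(\<lambda>x. if x = b then 1 else 0) = c0" by (rule c0) (use b in auto)
    show False using fun_cong[OF trans[OF 1 sym[OF 2]], of b] by simp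
  qed
  have "T y = 0" if "ntrace y = 0" for y
  proof -
    have "y \<in> span {commutator y z | y z. True}" using that by (simp only: ntrace_eq_0_iff)
    then show ?thesis
    proof (induction rule: span_induct_alt)
      case base
      then show ?case using T_scale[of 0 0] by simp
    next
      case (step c u v)
      from step(1) obtain y z where "u = commutator y z" by auto
      then show ?case using step(2) by (simp add: T_add T_scale T_commutator)
    qed
  qed
  then have "T (x - ntrace x *s 1) = 0" by simp
  moreover have "T (x - ntrace x *s 1 + ntrace x *s 1) = T (x - ntrace x *s 1) + to_ac (ntrace x) * of_nat n"
    by (simp only: T_add T_scale T_1)
  ultimately have "T x = to_ac (ntrace x) * of_nat n" by simp
  also have "\<dots> = to_ac (ntrace x * of_nat n)" by simp
  finally have "T x = 0 \<longleftrightarrow> ntrace x * of_nat n = 0" by (simp only: to_ac_eq_0_iff)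
  then show ?thesis using n by (simp add: T_def)
qed

text \<open>An element of \<open>sl1 scale R\<close> brings a splitting with it, and every splitting
  yields the kernel of \<open>ntrace\<close>. If there were no splitting, the left side would be
  empty.\<close>

lemma sl1_eq:
  assumes "sl1 scale R \<noteq> {}"
  shows "sl1 scale R = {x \<in> R. ntrace x = 0}"
proof -
  obtain n \<rho> where "splitting scale n \<rho>" using assms by (auto simp: sl1_def has_reduced_trace_def)
  then have "has_reduced_trace scale x 0 \<longleftrightarrow> ntrace x = 0" for x
    unfolding has_reduced_trace_def to_ac_0 using reduced_trace_eq_0_iff by blast
  then show ?thesis by (simp add: sl1_def)
qed

end

text \<open>Two of the \<open>N + 1\<close> elements \<open>\<pi> ^ i *s x\<close> share a coset, so
  \<open>(1 - \<pi> ^ d) *s \<pi> ^ i *s x\<close> lies in \<open>M\<close> for some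
  \<open>d > 0\<close>. The factor \<open>1 - \<pi> ^ d\<close> is 1 modulo \<open>p\<close>, hence
  a unit.\<close>

lemma (in padic_order) finite_index_power:
  assumes A: "Z.subspace A" and M: "Z.subspace M" and fin: "finite (add_cosets A M)"
  shows "\<exists>N. \<forall>x\<in>A. \<pi> ^ N *s x \<in> M"
proof -
  have scale: "\<pi> ^ n *s x \<in> S" if "Z.subspace S" "x \<in> S" for n x S
    using Z.subspace_scale[OF that, of "of_nat CARD('p) ^ n"] by (simp add: zp_scale_def padic_of_int_power)
  define N where "N = card (add_cosets A M)"
  have "\<pi> ^ N *s x \<in> M" if x: "x \<in> A" for x
  proof -
    define h where "h i = (\<lambda>y. \<pi> ^ i *s x + y) ` M" for i
    have "h ` {..N} \<subseteq> add_cosets A M" using scale[OF A x] by (auto simp: h_def add_cosets_def)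
    then have "card (h ` {..N}) \<le> N" unfolding N_def using fin by (rule card_mono[rotated])
    then have "\<not> inj_on h {..N}" using card_image[of h "{..N}"] by auto
    then obtain i j where ij: "i < j" "j \<le> N" "h i = h j" unfolding inj_on_def by (metis atMost_iff linorder_neqE_nat)
    have "\<pi> ^ i *s x + 0 \<in> h i" unfolding h_def using Z.subspace_0[OF M] by blast
    then obtain y where y: "y \<in> M" "\<pi> ^ i *s x = \<pi> ^ j *s x + y" unfolding ij(3) by (auto simp: h_def)
    define d where "d = j - i"
    have d: "d > 0" "\<pi> ^ j = \<pi> ^ i * \<pi> ^ d" using ij(1) by (simp_all add: d_def flip: power_add)
    have "Rep_padic_int (1 - of_nat CARD('p) ^ d :: 'p padic_int) 1 \<noteq> 0"
    proof
      assume "Rep_padic_int (1 - of_nat CARD('p) ^ d :: 'p padic_int) 1 = 0"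
      then have "of_nat CARD('p) ^ 1 dvd (1 - of_nat CARD('p) ^ d :: 'p padic_int)"
        by (simp only: padic_int_dvd_iff)
      moreover have "of_nat CARD('p) ^ 1 dvd (of_nat CARD('p) ^ d :: 'p padic_int)"
        using d(1) by (intro le_imp_power_dvd) simp
      ultimately have "of_nat CARD('p) ^ 1 dvd (1 - of_nat CARD('p) ^ d + of_nat CARD('p) ^ d :: 'p padic_int)"
        by (rule dvd_add)
      then have "Rep_padic_int (1 :: 'p padic_int) 1 = 0" by (simp only: padic_int_dvd_iff diff_add_cancel)
      then show False using card_prime_card_gt_1[where 'p = 'p] by (simp add: one_padic_int.rep_eq)
    qed
    then obtain u :: "'p padic_int" where u: "1 = (1 - of_nat CARD('p) ^ d) * u"
      using padic_int_unit by (metis dvd_def)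
    have "padic_of_int u * (1 - \<pi> ^ d) = padic_of_int (u * (1 - of_nat CARD('p) ^ d))"
      by (simp add: One_fract_def flip: padic_of_int_power)
    then have u': "padic_of_int u * (1 - \<pi> ^ d) = 1" using u by (simp add: mult.commute One_fract_def)
    have "\<pi> ^ d *s \<pi> ^ i *s x = \<pi> ^ j *s x" by (simp add: d(2) mult.commute)
    then have "(1 - \<pi> ^ d) *s \<pi> ^ i *s x = \<pi> ^ i *s x - \<pi> ^ j *s x"
      by (simp only: scale_left_diff_distrib scale_one)
    also have "\<dots> = y" by (subst y(2)) simp
    finally have eq: "(1 - \<pi> ^ d) *s \<pi> ^ i *s x = y" .
    have "padic_of_int u *s y = (padic_of_int u * (1 - \<pi> ^ d)) *s \<pi> ^ i *s x"
      unfolding eq[symmetric] by (simp add: mult.assoc)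
    then have "\<pi> ^ i *s x = zp_scale scale u y" unfolding u' by (simp add: zp_scale_def)
    then have "\<pi> ^ i *s x \<in> M" using Z.subspace_scale[OF M y(1)] by simp
    then have "\<pi> ^ (N - i) *s \<pi> ^ i *s x \<in> M" using scale[OF M] by blast
    then show ?thesis using ij by (simp flip: power_add)
  qed
  then show ?thesis by blast
qed

theorem theoremB:
  fixes scale :: "'p :: prime_card padic \<Rightarrow> 'd :: division_ring \<Rightarrow> 'd"
    and \<Delta> L :: "'d set"
  assumes "finite_dim_central_algebra scale"
    and "\<exists>x y :: 'd. x * y \<noteq> y * x"
    and "maximal_zp_order scale \<Delta>"
    and "lie_subalgebra (zp_scale scale) commutator (sl1 scale \<Delta>) L"
    and "finite (add_cosets (sl1 scale \<Delta>) L)"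
  shows "\<not> self_similar (zp_scale scale) commutator L"
proof
  assume "self_similar (zp_scale scale) commutator L"
  then obtain k M \<phi> where virtual: "virtual_endomorphism (zp_scale scale) commutator L k M \<phi>"
    and simple: "simple_endomorphism (zp_scale scale) commutator L M \<phi>"
    by (auto simp: self_similar_def self_similar_of_index_def)
  obtain Basis where "finite_dimensional_vector_space scale Basis"
    using assms(1) by (auto simp: finite_dim_central_algebra_def)
  then interpret finite_dimensional_vector_space scale Basis .
  interpret padic_order scale Basis \<Delta>
  proof
    fix a x y
    show "scale a x * y = scale a (x * y)" "x * scale a y = scale a (x * y)"
      using assms(1) by (auto simp: finite_dim_central_algebra_def)
    show "\<exists>a. z = scale a 1" if "\<And>x. z * x = x * z" for z
    proof -
      have "z \<in> {z. \<forall>x. z * x = x * z}" using that by blast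
      then show ?thesis using assms(1) unfolding finite_dim_central_algebra_def by blast
    qed
    show "zp_order scale \<Delta>" using assms(3) by (simp add: maximal_zp_order_def)
  qed
  have L: "L \<subseteq> sl1 scale \<Delta>" "Z.subspace L" using assms(4) by (auto simp: lie_subalgebra_def)
  \<comment> \<open>\<open>L\<close> contains 0, so \<open>sl1 scale \<Delta>\<close> is nonempty,
    as \<open>sl1_eq\<close> demands.\<close>
  then have sl1: "sl1 scale \<Delta> = {x \<in> \<Delta>. ntrace x = 0}" using Z.subspace_0 by (intro sl1_eq) blast
  have sub: "Z.subspace (sl1 scale \<Delta>)"
    unfolding sl1
  proof (rule Z.subspaceI)
    show "zp_scale scale c x \<in> {x \<in> \<Delta>. ntrace x = 0}" if "x \<in> {x \<in> \<Delta>. ntrace x = 0}" for c x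
      using that order_scale by (simp add: zp_scale_def)
  qed (use order_closed in auto)
  from finite_index_power[OF sub L(2) assms(5)] obtain N where N: "\<forall>x\<in>sl1 scale \<Delta>. scale (\<pi> ^ N) x \<in> L" ..
  have M: "M \<subseteq> L" "Z.subspace M" using virtual by (auto simp: virtual_endomorphism_def lie_subalgebra_def)
  have "card (add_cosets L M) \<noteq> 0" using virtual by (simp add: virtual_endomorphism_def)
  then have "finite (add_cosets L M)" by (rule contrapos_np) simp
  from finite_index_power[OF L(2) M(2) this] obtain N' where N': "\<forall>x\<in>L. scale (\<pi> ^ N') x \<in> M" ..
  interpret traceless_virtual_endomorphism scale Basis \<Delta> L M \<phi> "N' + N"
  proof
    show "L \<subseteq> \<Delta>" using L(1) sl1 by blast
    show "ntrace x = 0" if "x \<in> L" for x using that L(1) sl1 by blast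
    show "M \<subseteq> L" "Z.subspace M" by fact+
    show "scale (\<pi> ^ (N' + N)) x \<in> M" if "x \<in> \<Delta>" "ntrace x = 0" for x
      using N'[rule_format, OF N[rule_format, of x]] that sl1 by (simp add: power_add)
    fix x y a assume x: "x \<in> M"
    show "\<phi> x \<in> L" using virtual x by (auto simp: virtual_endomorphism_def)
    show "\<phi> (scale (padic_of_int a) x) = scale (padic_of_int a) (\<phi> x)"
      using virtual x by (auto simp: virtual_endomorphism_def zp_scale_def)
    assume y: "y \<in> M"
    show "commutator x y \<in> M" "\<phi> (x + y) = \<phi> x + \<phi> y" "\<phi> (commutator x y) = commutator (\<phi> x) (\<phi> y)"
      using virtual x y by (auto simp: virtual_endomorphism_def lie_subalgebra_def)
  qed
  show False using not_simple[OF assms(2)] simple by blast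
qed

end
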